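(* Let $\alpha \ge 2$ and $n \ge \alpha$ be integers, and let $\tau_{\alpha,\alpha} \in S_{2\alpha}$ be the pattern $[1,2,\dots,\alpha,2\alpha,2\alpha-1,\dots,\alpha+1]$. Then the $\tau_{\alpha,\alpha}$-maximal permutation of length $2n$ is $[1,2,\dots,n,2n,2n-1,\dots,n+1]$, independently of $\alpha$; that is, a permutation $\sigma \in S_{2n}$ is $\tau_{\alpha,\alpha}$-maximal if and only if $\sigma = [1,2,\dots,n,2n,2n-1,\dots,n+1]$.
   Context: Permutations are written in one-line notation. For $\sigma \in S_N$ and a pattern $\tau \in S_m$ with $m \le N$, an occurrence of $\tau$ in $\sigma$ is an $m$-subset $S \subseteq \{1,\dots,N\}$ such that the restriction of $\sigma$ to $S$ is order-isomorphic to $\tau$. Let $g(\tau,\sigma)$ be the number of occurrences of $\tau$ in $\sigma$, and let $g(\tau,N) = \max_{\sigma \in S_N} g(\tau,\sigma)$. A permutation $\sigma \in S_N$ is called $\tau$-maximal if $g(\tau,\sigma) = g(\tau,N)$. *)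

theory Defs
  imports Main "HOL-Combinatorics.Permutations"
begin

text \<open>An element of \<open>S_N\<close> is a function \<open>\<sigma> :: nat \<Rightarrow> nat\<close> with \<open>\<sigma> permutes {1..N}\<close>; such a
  function is the identity outside \<open>{1..N}\<close>, so equality in \<open>S_N\<close> is equality of functions.
  The lengths of permutations are therefore passed as explicit arguments below.\<close>

definition one_line :: "nat list \<Rightarrow> nat \<Rightarrow> nat" where
  "one_line xs i = (if i \<in> {1..length xs} then xs ! (i - 1) else i)"

text \<open>\<open>[1, 2, ..., k, 2k, 2k-1, ..., k+1]\<close>\<close>

definition tau_list :: "nat \<Rightarrow> nat list" where
  "tau_list k = [1..<k + 1] @ rev [k + 1..<2 * k + 1]"

text \<open>The increasing enumeration \<open>f\<close> of \<open>S\<close> witnesses that \<open>\<sigma>\<close> restricted to \<open>S\<close> is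
  order-isomorphic to \<open>\<tau> \<in> S_m\<close>. Its existence forces \<open>card S = m\<close>.\<close>

definition order_iso_to :: "nat \<Rightarrow> (nat \<Rightarrow> nat) \<Rightarrow> (nat \<Rightarrow> nat) \<Rightarrow> nat set \<Rightarrow> bool" where
  "order_iso_to m \<tau> \<sigma> S \<longleftrightarrow>
     (\<exists>f. strict_mono_on {1..m} f \<and> f ` {1..m} = S \<and>
          (\<forall>i\<in>{1..m}. \<forall>j\<in>{1..m}. \<sigma> (f i) < \<sigma> (f j) \<longleftrightarrow> \<tau> i < \<tau> j))"

definition occurrences :: "nat \<Rightarrow> (nat \<Rightarrow> nat) \<Rightarrow> nat \<Rightarrow> (nat \<Rightarrow> nat) \<Rightarrow> nat set set" where
  "occurrences m \<tau> N \<sigma> = {S. S \<subseteq> {1..N} \<and> card S = m \<and> order_iso_to m \<tau> \<sigma> S}"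

definition occ_count :: "nat \<Rightarrow> (nat \<Rightarrow> nat) \<Rightarrow> nat \<Rightarrow> (nat \<Rightarrow> nat) \<Rightarrow> nat" where
  "occ_count m \<tau> N \<sigma> = card (occurrences m \<tau> N \<sigma>)"

definition max_occ_count :: "nat \<Rightarrow> (nat \<Rightarrow> nat) \<Rightarrow> nat \<Rightarrow> nat" where
  "max_occ_count m \<tau> N = Max (occ_count m \<tau> N ` {\<sigma>. \<sigma> permutes {1..N}})"

definition pattern_maximal :: "nat \<Rightarrow> (nat \<Rightarrow> nat) \<Rightarrow> nat \<Rightarrow> (nat \<Rightarrow> nat) \<Rightarrow> bool" where
  "pattern_maximal m \<tau> N \<sigma> \<longleftrightarrow>
     \<sigma> permutes {1..N} \<and> occ_count m \<tau> N \<sigma> = max_occ_count m \<tau> N"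

lemma one_line_permutes:
  assumes "distinct xs" and "set xs = {1..length xs}"
  shows "one_line xs permutes {1..length xs}"
proof (rule bij_imp_permutes)
  have "inj_on (one_line xs) {1..length xs}"
    using assms(1) by (auto simp: inj_on_def one_line_def nth_eq_iff_index_eq)
  moreover have "one_line xs ` {1..length xs} \<subseteq> {1..length xs}"
  proof
    fix y assume "y \<in> one_line xs ` {1..length xs}"
    then obtain i where "i \<in> {1..length xs}" "y = xs ! (i - 1)"
      by (auto simp: one_line_def)
    then have "y \<in> set xs" by auto
    then show "y \<in> {1..length xs}" using assms(2) by blast
  qed
  ultimately show "bij_betw (one_line xs) {1..length xs} {1..length xs}"
    by (simp add: bij_betw_def endo_inj_surj)
qed (auto simp: one_line_def)

lemma length_tau_list: "length (tau_list k) = 2 * k"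
  by (simp add: tau_list_def)

lemma one_line_tau_list_permutes: "one_line (tau_list k) permutes {1..2 * k}"
proof -
  have "set (tau_list k) = {1..2 * k}" "distinct (tau_list k)"
    by (auto simp: tau_list_def)
  then show ?thesis
    using one_line_permutes[of "tau_list k"] by (simp add: length_tau_list)
qed

end

theory Submission imports Defs "HOL-Library.Infinite_Set" begin

text \<open>
  Only the strict order \<open>i < j \<and> \<sigma> i < \<sigma> j\<close> on positions matters: an occurrence of the pattern is an
  \<open>\<alpha>\<close>-chain lying completely below an \<open>\<alpha>\<close>-antichain. The maximum is taken over all strict orders
  on \<open>2n\<close> elements, where elements can be moved freely.

  Fix an order with the maximal number of occurrences. Moving an element that is in no top antichain
  to the bottom, and making one of two incomparable elements a twin of the other (Zykov
  symmetrization), cannot increase the count. This forces the order to be a chain \<open>L\<close> of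
  \<open>m \<ge> \<alpha>\<close> elements below a stack of antichain layers with at least \<open>\<alpha>\<close> elements each; let \<open>y\<close> be
  the size of the top layer.

  If there are several layers, turning the lowest one into a chain shows \<open>y \<le> m\<close>. Merging the
  second layer from the top into the top one gains if \<open>y < m\<close> and does not lose if \<open>y = m\<close>. With a
  single layer, moving one element gives \<open>y = m\<close>, using that \<open>m + y = 2n\<close> is even. So \<open>y = m\<close> for
  every maximal order; with several layers the merged order would be maximal too, with the same \<open>m\<close>
  but larger \<open>y\<close>. Hence there is one layer and \<open>m = y = n\<close>.
\<close>

section \<open>Chains below antichains in a strict order\<close>

text \<open>Confining \<open>r\<close> to \<open>V \<times> V\<close> makes the strict orders on a
  finite set a finite family, so that a maximal one exists.\<close>

definition strict_order_on :: "'a set \<Rightarrow> ('a \<times> 'a) set \<Rightarrow> bool" where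
  "strict_order_on V r \<longleftrightarrow> r \<subseteq> V \<times> V \<and> irrefl r \<and> trans r"

definition is_chain :: "('a \<times> 'a) set \<Rightarrow> 'a set \<Rightarrow> bool" where
  "is_chain r A \<longleftrightarrow> (\<forall>a\<in>A. \<forall>b\<in>A. a \<noteq> b \<longrightarrow> (a, b) \<in> r \<or> (b, a) \<in> r)"

definition is_antichain :: "('a \<times> 'a) set \<Rightarrow> 'a set \<Rightarrow> bool" where
  "is_antichain r D \<longleftrightarrow> (\<forall>a\<in>D. \<forall>b\<in>D. (a, b) \<notin> r)"

definition occs :: "nat \<Rightarrow> 'a set \<Rightarrow> ('a \<times> 'a) set \<Rightarrow> ('a set \<times> 'a set) set" where
  "occs k V r = {(A, D). A \<subseteq> V \<and> D \<subseteq> V \<and> card A = k \<and> card D = k \<and>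
     is_chain r A \<and> is_antichain r D \<and> A \<times> D \<subseteq> r}"

lemma occsI:
  assumes "A \<subseteq> V" "D \<subseteq> V" "card A = k" "card D = k" "is_chain r A" "is_antichain r D"
    "\<And>a d. a \<in> A \<Longrightarrow> d \<in> D \<Longrightarrow> (a, d) \<in> r"
  shows "(A, D) \<in> occs k V r"
  using assms by (auto simp: occs_def)

lemma occsD:
  assumes "(A, D) \<in> occs k V r"
  shows "A \<subseteq> V" "D \<subseteq> V" "card A = k" "card D = k" "is_chain r A" "is_antichain r D"
    "\<And>a d. a \<in> A \<Longrightarrow> d \<in> D \<Longrightarrow> (a, d) \<in> r"
  using assms by (auto simp: occs_def)

lemma is_chain_subset: "is_chain r A \<Longrightarrow> B \<subseteq> A \<Longrightarrow> is_chain r B"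
  unfolding is_chain_def by blast

lemma is_antichain_subset: "is_antichain r A \<Longrightarrow> B \<subseteq> A \<Longrightarrow> is_antichain r B"
  unfolding is_antichain_def by blast

lemma finite_occs: "finite V \<Longrightarrow> finite (occs k V r)"
  by (rule finite_subset[of _ "Pow V \<times> Pow V"]) (auto simp: occs_def)

text \<open>The bookkeeping behind the exchange arguments: \<open>lost\<close> need only cover what
  disappears and \<open>new\<close> need only sample what appears.\<close>

lemma exchange_card:
  assumes "finite V" "finite lost" "occs k V r - lost \<subseteq> occs k V s"
    "new \<subseteq> occs k V s" "new \<inter> occs k V r = {}"
  shows "card (occs k V r) + card new \<le> card (occs k V s) + card lost"
proof -
  have fin: "finite (occs k V r)" "finite (occs k V s)" "finite new"
    using assms finite_occs finite_subset by blast+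
  have "card (occs k V r) \<le> card (occs k V r - lost) + card lost"
    by (metis assms(2) card_Diff_subset_Int diff_card_le_card_Diff fin(1) finite_Int le_diff_conv)
  moreover have "card (occs k V r - lost) + card new = card ((occs k V r - lost) \<union> new)"
    using fin assms(5) by (subst card_Un_disjoint) auto
  moreover have "\<dots> \<le> card (occs k V s)"
    using assms fin by (intro card_mono) auto
  ultimately show ?thesis by linarith
qed

section \<open>Two ways of rearranging an order\<close>

text \<open>\<open>X\<close> is moved below everything else and made a chain. The linear order of
  the type serves only to choose such a chain.\<close>

definition chain_below :: "'a::linorder set \<Rightarrow> 'a set \<Rightarrow> ('a \<times> 'a) set \<Rightarrow> ('a \<times> 'a) set" where
  "chain_below V X r =
     {(a, b). a \<in> V \<and> b \<in> V \<and> (if a \<in> X then b \<in> X \<longrightarrow> a < b else b \<notin> X \<and> (a, b) \<in> r)}"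

lemma strict_order_on_chain_below:
  assumes "strict_order_on V r"
  shows "strict_order_on V (chain_below V X r)"
proof -
  have "trans (chain_below V X r)"
  proof (rule transI)
    fix a b c assume ab: "(a, b) \<in> chain_below V X r" "(b, c) \<in> chain_below V X r"
    then show "(a, c) \<in> chain_below V X r"
      using assms transD[of r a b c]
      by (fastforce simp: chain_below_def strict_order_on_def split: if_splits)
  qed
  then show ?thesis
    using assms by (auto simp: strict_order_on_def chain_below_def irrefl_def split: if_splits)
qed

text \<open>Pairs outside \<open>X\<close> are untouched and any pair meeting \<open>X\<close>
  becomes comparable, so only antichains meeting \<open>X\<close> can be destroyed.\<close>

lemma occs_chain_below:
  assumes "(A, D) \<in> occs k V r" "D \<inter> X = {}"
  shows "(A, D) \<in> occs k V (chain_below V X r)"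
proof (rule occsI)
  note o = occsD[OF assms(1)]
  show "A \<subseteq> V" "D \<subseteq> V" "card A = k" "card D = k" by fact+
  show "is_chain (chain_below V X r) A"
    unfolding is_chain_def
  proof (intro ballI impI)
    fix a b assume "a \<in> A" "b \<in> A" "a \<noteq> b"
    then have "a \<in> V" "b \<in> V" "(a, b) \<in> r \<or> (b, a) \<in> r" "a < b \<or> b < a"
      using o(1,5) by (auto simp: is_chain_def)
    then show "(a, b) \<in> chain_below V X r \<or> (b, a) \<in> chain_below V X r"
      by (auto simp: chain_below_def)
  qed
  show "is_antichain (chain_below V X r) D"
    using o(6) assms(2) by (auto simp: is_antichain_def chain_below_def)
  show "(a, d) \<in> chain_below V X r" if "a \<in> A" "d \<in> D" for a d
    using that o(1,2) o(7)[OF that] assms(2) by (auto simp: chain_below_def)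
qed

text \<open>The preimage of \<open>r\<close> under \<open>g\<close>: points with the same image
  become incomparable twins. With \<open>g = id(y := x)\<close> this is Zykov symmetrization; a
  \<open>g\<close> collapsing a whole layer serves for merging.\<close>

definition pull :: "'a set \<Rightarrow> ('a \<Rightarrow> 'a) \<Rightarrow> ('a \<times> 'a) set \<Rightarrow> ('a \<times> 'a) set" where
  "pull V g r = {(a, b). a \<in> V \<and> b \<in> V \<and> (g a, g b) \<in> r}"

lemma strict_order_on_pull:
  assumes "strict_order_on V r"
  shows "strict_order_on V (pull V g r)"
proof -
  have "trans (pull V g r)"
    using assms by (auto simp: strict_order_on_def pull_def intro!: transI dest: transD)
  then show ?thesis
    using assms by (auto simp: strict_order_on_def pull_def irrefl_def)
qed

text \<open>The factor 2 comes from occurrences through \<open>x\<close> only and their copies through its new twin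
  \<open>y\<close>.\<close>

lemma card_occs_twin:
  assumes fin: "finite V" and V: "x \<in> V" "y \<in> V" and ne: "x \<noteq> y"
  shows "card {(A, D) \<in> occs k V r. x \<notin> A \<union> D \<and> y \<notin> A \<union> D} +
      2 * card {(A, D) \<in> occs k V r. x \<in> A \<union> D \<and> y \<notin> A \<union> D} +
      card {(A, D) \<in> occs k V (pull V (id(y := x)) r). x \<in> A \<union> D \<and> y \<in> A \<union> D}
    \<le> card (occs k V (pull V (id(y := x)) r))"
proof -
  define s where "s = pull V (id(y := x)) r"
  define N0 where "N0 = {(A, D) \<in> occs k V r. x \<notin> A \<union> D \<and> y \<notin> A \<union> D}"
  define Nx where "Nx = {(A, D) \<in> occs k V r. x \<in> A \<union> D \<and> y \<notin> A \<union> D}"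
  define Q where "Q = {(A, D) \<in> occs k V s. x \<in> A \<union> D \<and> y \<in> A \<union> D}"
  \<comment> \<open>The transposition of \<open>x\<close> and \<open>y\<close> carries the
    occurrences through \<open>x\<close> only to their copies through \<open>y\<close> only.\<close>
  define t where "t = (\<lambda>v. if v = x then y else if v = y then x else v)"
  define T where "T = (\<lambda>(A, D). (t ` A, t ` D))"
  have tt: "t (t v) = v" for v by (simp add: t_def)
  then have injt: "inj t" by (metis injI)
  have TT: "T (T p) = p" for p
    by (cases p) (simp add: T_def image_image tt)
  have injT: "inj_on T Nx" by (metis TT inj_onI)
  have s_iff: "(a, b) \<in> s \<longleftrightarrow> a \<in> V \<and> b \<in> V \<and> ((id(y := x)) a, (id(y := x)) b) \<in> r" for a b
    by (simp add: s_def pull_def)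
  have same: "(A, D) \<in> occs k V s" if "(A, D) \<in> occs k V r" "y \<notin> A \<union> D" for A D
  proof (rule occsI)
    note o = occsD[OF that(1)]
    show "A \<subseteq> V" "D \<subseteq> V" "card A = k" "card D = k" by fact+
    have "(a, b) \<in> s \<longleftrightarrow> (a, b) \<in> r" if "a \<in> A \<union> D" "b \<in> A \<union> D" for a b
    proof -
      have "a \<noteq> y" "b \<noteq> y" using that \<open>y \<notin> A \<union> D\<close> by auto
      then show ?thesis using o(1,2) that by (auto simp: s_iff)
    qed
    then show "is_chain s A" "is_antichain s D" "\<And>a d. a \<in> A \<Longrightarrow> d \<in> D \<Longrightarrow> (a, d) \<in> s"
      using o(5-7) by (simp_all add: is_chain_def is_antichain_def)
  qed
  have swapped: "T p \<in> occs k V s" if "p \<in> Nx" for p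
  proof -
    obtain A D where p: "p = (A, D)" by (cases p)
    have AD: "(A, D) \<in> occs k V r" "y \<notin> A \<union> D" using that by (auto simp: Nx_def p)
    note o = occsD[OF AD(1)]
    have tV: "t v \<in> V" if "v \<in> V" for v using that V by (auto simp: t_def)
    have "(id(y := x)) (t a) = a" if "a \<noteq> y" for a
      using that by (simp add: t_def)
    moreover have "t a \<in> V" "a \<noteq> y" if "a \<in> A \<union> D" for a
      using that AD(2) o(1,2) tV by blast+
    ultimately have "(t a, t b) \<in> s \<longleftrightarrow> (a, b) \<in> r" if "a \<in> A \<union> D" "b \<in> A \<union> D" for a b
      using that by (simp add: s_iff)
    then have "is_chain s (t ` A)" "is_antichain s (t ` D)"
        "\<And>a d. a \<in> t ` A \<Longrightarrow> d \<in> t ` D \<Longrightarrow> (a, d) \<in> s"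
      using o(5-7) by (auto simp: is_chain_def is_antichain_def)
    then have "(t ` A, t ` D) \<in> occs k V s"
      using o(1-4) tV by (intro occsI) (auto simp: card_image inj_on_subset[OF injt])
    then show ?thesis by (simp add: T_def p)
  qed
  have sub: "N0 \<union> Nx \<union> T ` Nx \<union> Q \<subseteq> occs k V s"
    using same swapped by (auto simp: N0_def Nx_def Q_def)
  have x_swap: "y \<in> A \<union> D \<and> x \<notin> A \<union> D" if "(A, D) \<in> T ` Nx" for A D
  proof -
    have "T (A, D) \<in> Nx" using that TT by force
    then have "x \<in> t ` A \<union> t ` D" "y \<notin> t ` A \<union> t ` D" by (auto simp: Nx_def T_def)
    moreover have "v \<in> t ` S \<longleftrightarrow> t v \<in> S" for v S using tt by (metis image_iff)
    ultimately show ?thesis using ne by (auto simp: t_def)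
  qed
  have fins: "finite N0" "finite Nx" "finite Q" "finite (T ` Nx)"
    using finite_occs[OF fin] sub by (auto intro: finite_subset[OF _ finite_occs[OF fin, of k s]])
  have "card (N0 \<union> Nx \<union> T ` Nx \<union> Q) = card N0 + card Nx + card (T ` Nx) + card Q"
  proof -
    have "N0 \<inter> Nx = {}" by (auto simp: N0_def Nx_def)
    moreover have "(A, D) \<notin> T ` Nx" if "(A, D) \<in> N0 \<union> Nx" for A D
    proof -
      have "y \<notin> A \<union> D" using that by (auto simp: N0_def Nx_def)
      then show ?thesis using x_swap by blast
    qed
    then have "(N0 \<union> Nx) \<inter> T ` Nx = {}" by auto
    moreover have "(A, D) \<notin> N0 \<union> Nx \<union> T ` Nx" if "(A, D) \<in> Q" for A D
    proof -
      have "x \<in> A \<union> D" "y \<in> A \<union> D" using that by (auto simp: Q_def)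
      moreover from this have "(A, D) \<notin> T ` Nx" using x_swap by blast
      ultimately show ?thesis by (auto simp: N0_def Nx_def)
    qed
    then have "(N0 \<union> Nx \<union> T ` Nx) \<inter> Q = {}" by auto
    ultimately show ?thesis using fins by (simp add: card_Un_disjoint)
  qed
  moreover have "card (T ` Nx) = card Nx" using injT by (rule card_image)
  ultimately show ?thesis
    using card_mono[OF finite_occs[OF fin] sub] by (simp add: N0_def Nx_def Q_def s_def)
qed

section \<open>Maximal orders\<close>

text \<open>Optimality is asked among all strict orders on \<open>V\<close>, not only those coming
  from permutations, so that every rearrangement is an admissible competitor. Nonemptiness of
  \<open>occs k V r\<close> excludes the degenerate case where all counts vanish.\<close>

locale optimal_order =
  fixes k :: nat and V :: "'a::linorder set" and r :: "('a \<times> 'a) set"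
  assumes k2: "k \<ge> 2" and finV: "finite V" and order: "strict_order_on V r"
    and occs_ne: "occs k V r \<noteq> {}"
    and optimal: "\<And>s. strict_order_on V s \<Longrightarrow> card (occs k V s) \<le> card (occs k V r)"
begin

lemma r_V: "(a, b) \<in> r \<Longrightarrow> a \<in> V \<and> b \<in> V"
  and r_irrefl: "(a, a) \<notin> r"
  and r_trans: "(a, b) \<in> r \<Longrightarrow> (b, c) \<in> r \<Longrightarrow> (a, c) \<in> r"
  using order by (auto simp: strict_order_on_def irrefl_def dest: transD)

lemma exchange_le:
  assumes "strict_order_on V s" "finite lost" "occs k V r - lost \<subseteq> occs k V s"
    "new \<subseteq> occs k V s" "new \<inter> occs k V r = {}"
  shows "card new \<le> card lost"
  using exchange_card[OF finV assms(2-5)] optimal[OF assms(1)] by linarith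

lemma occs_maximal:
  assumes "strict_order_on V s" "occs k V r \<subseteq> occs k V s"
  shows "occs k V s = occs k V r"
  using optimal[OF assms(1)] assms(2) finite_occs[OF finV] by (metis card_seteq)

abbreviation incomp :: "'a \<Rightarrow> 'a \<Rightarrow> bool" where
  "incomp u v \<equiv> (u, v) \<notin> r \<and> (v, u) \<notin> r"

text \<open>Turning \<open>y\<close> into a twin of \<open>x\<close>, or \<open>x\<close> into a twin of \<open>y\<close>: on average this gains, unless no
  occurrence through the pair of twins is new.\<close>

lemma twin:
  assumes V: "x \<in> V" "y \<in> V" and ne: "x \<noteq> y" and inc: "incomp x y"
    and AD: "(A, D) \<in> occs k V (pull V (id(y := x)) r)" and xy: "x \<in> A \<union> D" "y \<in> A \<union> D"
  shows "(A, D) \<in> occs k V r"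
proof -
  define Nxy where "Nxy = {(A, D) \<in> occs k V r. x \<in> A \<union> D \<and> y \<in> A \<union> D}"
  define Nx where "Nx = {(A, D) \<in> occs k V r. x \<in> A \<union> D \<and> y \<notin> A \<union> D}"
  define Ny where "Ny = {(A, D) \<in> occs k V r. y \<in> A \<union> D \<and> x \<notin> A \<union> D}"
  define N0 where "N0 = {(A, D) \<in> occs k V r. x \<notin> A \<union> D \<and> y \<notin> A \<union> D}"
  define Qx where "Qx = {(A, D) \<in> occs k V (pull V (id(y := x)) r). x \<in> A \<union> D \<and> y \<in> A \<union> D}"
  define Qy where "Qy = {(A, D) \<in> occs k V (pull V (id(x := y)) r). y \<in> A \<union> D \<and> x \<in> A \<union> D}"
  have N0': "N0 = {(A, D) \<in> occs k V r. y \<notin> A \<union> D \<and> x \<notin> A \<union> D}" by (auto simp: N0_def)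
  have fins: "finite (occs k V s)" for s using finite_occs[OF finV] .
  have finQ: "finite Qx" "finite Qy"
    by (rule finite_subset[OF _ fins], force simp: Qx_def Qy_def)+
  have 1: "card N0 + 2 * card Nx + card Qx \<le> card (occs k V r)"
    using card_occs_twin[OF finV V ne, of k r] optimal[OF strict_order_on_pull[OF order]]
    unfolding N0_def Nx_def Qx_def by (meson le_trans)
  have 2: "card N0 + 2 * card Ny + card Qy \<le> card (occs k V r)"
    using card_occs_twin[OF finV V(2,1) ne[symmetric], of k r] optimal[OF strict_order_on_pull[OF order]]
    unfolding N0' Ny_def Qy_def by (meson le_trans)
  have "occs k V r = N0 \<union> Nx \<union> Ny \<union> Nxy"
    by (auto simp: N0_def Nx_def Ny_def Nxy_def)
  moreover have "card (N0 \<union> Nx \<union> Ny \<union> Nxy) \<le> card N0 + card Nx + card Ny + card Nxy"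
    using card_Un_le[of "N0 \<union> Nx \<union> Ny" Nxy] card_Un_le[of "N0 \<union> Nx" Ny] card_Un_le[of N0 Nx]
    by linarith
  ultimately have "card (occs k V r) \<le> card N0 + card Nx + card Ny + card Nxy" by simp
  \<comment> \<open>In the sum of bounds 1 and 2, everything outside \<open>Nxy\<close> cancels
    against twice the total. As \<open>Nxy\<close> lies in both \<open>Qx\<close> and
    \<open>Qy\<close>, this forces \<open>Nxy = Qx\<close>.\<close>
  then have 3: "card Qx + card Qy \<le> 2 * card Nxy" using 1 2 by linarith
  \<comment> \<open>Two incomparable elements of one occurrence both lie in \<open>D\<close>, and
    making one a twin of the other preserves that occurrence.\<close>
  have sub: "Nxy \<subseteq> occs k V (pull V (id(v := u)) r)" if uv: "{u, v} = {x, y}" for u v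
  proof (clarsimp simp: Nxy_def simp del: Un_iff)
    fix A D assume AD: "(A, D) \<in> occs k V r" and m: "x \<in> A \<union> D" "y \<in> A \<union> D"
    note o = occsD[OF AD]
    have D: "x \<in> D" "y \<in> D"
      using m o(5,7) inc ne by (auto simp: is_chain_def)
    then have A: "x \<notin> A" "y \<notin> A" using o(7) inc by auto
    have u: "u \<in> D" "v \<notin> A" using D A uv by (auto simp: doubleton_eq_iff)
    show "(A, D) \<in> occs k V (pull V (id(v := u)) r)"
      using o u by (intro occsI) (auto simp: pull_def is_chain_def is_antichain_def)
  qed
  have "Nxy \<subseteq> Qx" "Nxy \<subseteq> Qy"
    using sub[of x y] sub[of y x] by (auto simp: Nxy_def Qx_def Qy_def)
  then have "card Nxy \<le> card Qy" "Nxy \<subseteq> Qx" using finQ card_mono by blast+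
  then have "Nxy = Qx" using 3 finQ card_seteq[of Qx Nxy] by linarith
  moreover have "(A, D) \<in> Qx" using AD xy by (auto simp: Qx_def)
  ultimately show ?thesis by (auto simp: Nxy_def)
qed

text \<open>Once \<open>y\<close> is a twin of \<open>x\<close>, adding both to \<open>E\<close>
  gives an antichain of exactly \<open>k\<close> elements above \<open>A\<close>. By
  \<open>twin\<close> this occurrence was present already in \<open>r\<close>, which fixes how
  \<open>y\<close> compares with \<open>A\<close> and \<open>E\<close>.\<close>

lemma twin_extend:
  assumes V: "x \<in> V" "y \<in> V" and ne: "x \<noteq> y" and inc: "incomp x y"
    and A: "A \<subseteq> V" "card A = k" "is_chain r A"
    and E: "E \<subseteq> V" "card E = k - 2" "is_antichain r (insert x E)" "x \<notin> E" "y \<notin> E"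
    and AE: "\<And>a e. a \<in> A \<Longrightarrow> e \<in> insert x E \<Longrightarrow> (a, e) \<in> r"
  shows "\<And>a. a \<in> A \<Longrightarrow> (a, y) \<in> r" "\<And>e. e \<in> E \<Longrightarrow> incomp e y"
proof -
  have finE: "finite E" using E(1) finV finite_subset by blast
  have yA: "y \<notin> A" using AE inc by blast
  have "(A, insert x (insert y E)) \<in> occs k V (pull V (id(y := x)) r)"
  proof (rule occsI)
    show "card (insert x (insert y E)) = k" using E ne finE k2 by simp
    show "is_antichain (pull V (id(y := x)) r) (insert x (insert y E))"
      using E(3) by (auto simp: is_antichain_def pull_def)
    show "is_chain (pull V (id(y := x)) r) A"
      using A yA by (auto simp: is_chain_def pull_def subset_iff)
    show "(a, d) \<in> pull V (id(y := x)) r" if "a \<in> A" "d \<in> insert x (insert y E)" for a d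
      using that AE yA A(1) E(1) V by (auto simp: pull_def)
  qed (use A E V in auto)
  then have "(A, insert x (insert y E)) \<in> occs k V r"
    using twin[OF V ne inc] by simp
  note o = occsD[OF this]
  show "\<And>a. a \<in> A \<Longrightarrow> (a, y) \<in> r" "\<And>e. e \<in> E \<Longrightarrow> incomp e y"
    using o(6,7) by (auto simp: is_antichain_def)
qed

section \<open>Elements comparable to all others: the prospective lower chain\<close>

definition L :: "'a set" where
  "L = {v \<in> V. \<forall>u\<in>V. u \<noteq> v \<longrightarrow> (u, v) \<in> r \<or> (v, u) \<in> r}"

lemma L_V: "L \<subseteq> V" by (auto simp: L_def)

lemma fin_L: "finite L" using L_V finV finite_subset by blast

text \<open>An element in no top antichain can move to the very bottom without losing an occurrence, so
  all its comparabilities are already there.\<close>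

lemma useless_below:
  assumes x: "x \<in> V" "\<And>A D. (A, D) \<in> occs k V r \<Longrightarrow> x \<notin> D"
    and AD: "A \<subseteq> V" "D \<subseteq> V" "card A = k - 1" "card D = k" "is_chain r A" "is_antichain r D"
      "\<And>a d. a \<in> A \<Longrightarrow> d \<in> D \<Longrightarrow> (a, d) \<in> r" "x \<notin> A" "x \<notin> D"
  shows "(insert x A, D) \<in> occs k V r"
proof -
  let ?s = "chain_below V {x} r"
  have "occs k V r \<subseteq> occs k V ?s"
    using x(2) by (auto intro!: occs_chain_below)
  then have eq: "occs k V ?s = occs k V r"
    using occs_maximal strict_order_on_chain_below[OF order] by blast
  have finA: "finite A" using AD(1) finV finite_subset by blast
  have "(insert x A, D) \<in> occs k V ?s"
  proof (rule occsI)
    show "card (insert x A) = k" using AD finA k2 by simp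
    show "is_chain ?s (insert x A)"
      using AD(1,5,8) x(1) by (fastforce simp: is_chain_def chain_below_def)
    show "is_antichain ?s D" using AD(6,9) by (auto simp: is_antichain_def chain_below_def)
    show "(a, d) \<in> ?s" if "a \<in> insert x A" "d \<in> D" for a d
      using that AD(1,2,7,8,9) x(1) by (auto simp: chain_below_def)
  qed (use AD x in auto)
  then show ?thesis using eq by simp
qed

text \<open>Such an \<open>x\<close> may replace any element of a lower chain, by
  \<open>useless_below\<close>; the resulting occurrences supply the comparisons.\<close>

lemma useless:
  assumes x: "x \<in> V" "\<And>A D. (A, D) \<in> occs k V r \<Longrightarrow> x \<notin> D"
    and o: "(A, D) \<in> occs k V r"
  shows "\<And>a. a \<in> A \<Longrightarrow> a \<noteq> x \<Longrightarrow> (a, x) \<in> r \<or> (x, a) \<in> r"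
    and "\<And>d. d \<in> D \<Longrightarrow> (x, d) \<in> r"
    and "\<And>a. a \<in> A \<Longrightarrow> x \<notin> A \<Longrightarrow> (insert x (A - {a}), D) \<in> occs k V r"
proof -
  note o' = occsD[OF o]
  have fA: "finite A" using o'(1) finV finite_subset by blast
  show 1: "(insert x (A - {a}), D) \<in> occs k V r" if "a \<in> A" "x \<notin> A" for a
  proof (rule useless_below[OF x])
    show "card (A - {a}) = k - 1" using that(1) o'(3) fA by simp
    show "is_chain r (A - {a})" using o'(5) by (rule is_chain_subset) auto
    show "x \<notin> D" using x(2) o by blast
  qed (use o' that in auto)
  \<comment> \<open>To compare \<open>x\<close> with a given \<open>a\<close> in \<open>A\<close>, a
    different element of \<open>A\<close> has to make room for \<open>x\<close>.\<close>
  obtain b c where bc: "b \<in> A" "c \<in> A" "b \<noteq> c"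
    using o'(3) k2 by (metis card_2_iff' card_le_Suc0_iff_eq fA le_antisym not_less_eq_eq numeral_2_eq_2)
  show "(x, d) \<in> r" if d: "d \<in> D" for d
  proof (cases "x \<in> A")
    case False
    with 1[OF bc(1)] d show ?thesis by (auto dest: occsD(7))
  qed (use d o' in auto)
  show "(a, x) \<in> r \<or> (x, a) \<in> r" if a: "a \<in> A" "a \<noteq> x" for a
  proof (cases "x \<in> A")
    case True
    then show ?thesis using a o'(5) by (auto simp: is_chain_def)
  next
    case False
    obtain e where "e \<in> A" "e \<noteq> a" using bc by metis
    with 1[OF this(1) False] a show ?thesis
      using occsD(5) by (fastforce simp: is_chain_def)
  qed
qed

text \<open>An antichain of \<open>k \<ge> 2\<close> elements gives each member an incomparable
  partner. Conversely, let \<open>v\<close> be in no top antichain and \<open>u\<close> be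
  incomparable to \<open>v\<close>. If \<open>u\<close> is in a top antichain,
  \<open>useless\<close> puts \<open>v\<close> below \<open>u\<close>; otherwise \<open>u\<close>
  can be moved into a lower chain, and \<open>useless\<close> makes \<open>v\<close> comparable to
  it.\<close>

lemma not_L_iff:
  assumes "v \<in> V"
  shows "v \<notin> L \<longleftrightarrow> (\<exists>A D. (A, D) \<in> occs k V r \<and> v \<in> D)"
proof
  assume "\<exists>A D. (A, D) \<in> occs k V r \<and> v \<in> D"
  then obtain A D where o: "(A, D) \<in> occs k V r" "v \<in> D" by blast
  note o' = occsD[OF o(1)]
  have "finite D" using o'(2) finV finite_subset by blast
  then obtain w where "w \<in> D" "w \<noteq> v"
    using o'(4) k2 by (metis card_le_Suc0_iff_eq not_less_eq_eq numeral_2_eq_2 o(2))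
  then show "v \<notin> L" using o o'(2,6) by (auto simp: L_def is_antichain_def subset_iff)
next
  assume "v \<notin> L"
  show "\<exists>A D. (A, D) \<in> occs k V r \<and> v \<in> D"
  proof (rule ccontr)
    assume "\<not> ?thesis"
    then have us: "\<And>A D. (A, D) \<in> occs k V r \<Longrightarrow> v \<notin> D" by blast
    obtain u where u: "u \<in> V" "u \<noteq> v" "incomp u v"
      using \<open>v \<notin> L\<close> assms by (auto simp: L_def)
    show False
    proof (cases "\<exists>A D. (A, D) \<in> occs k V r \<and> u \<in> D")
      case True
      then obtain A D where o: "(A, D) \<in> occs k V r" "u \<in> D" by blast
      have "(v, u) \<in> r" by (rule useless(2)[OF assms _ o]) (rule us)
      then show False using u by blast
    next
      case False
      then have us': "\<And>A D. (A, D) \<in> occs k V r \<Longrightarrow> u \<notin> D" by blast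
      obtain A D where o: "(A, D) \<in> occs k V r" using occs_ne by auto
      have "\<exists>A'. (A', D) \<in> occs k V r \<and> u \<in> A'"
      proof (cases "u \<in> A")
        case False
        have "A \<noteq> {}" using occsD(3)[OF o] k2 by auto
        then obtain a where "a \<in> A" by blast
        have "(insert u (A - {a}), D) \<in> occs k V r"
          by (rule useless(3)[OF u(1) _ o \<open>a \<in> A\<close> False]) (rule us')
        then show ?thesis by blast
      qed (use o in blast)
      then obtain A' where o': "(A', D) \<in> occs k V r" "u \<in> A'" by blast
      have "(u, v) \<in> r \<or> (v, u) \<in> r" by (rule useless(1)[OF assms _ o' u(2)]) (rule us)
      then show False using u by blast
    qed
  qed
qed

lemma L_below: "v \<in> L \<Longrightarrow> h \<in> V - L \<Longrightarrow> (v, h) \<in> r"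
  using useless(2)[of v] not_L_iff L_V by (metis DiffE subsetD)

lemma is_chain_L: "A \<subseteq> L \<Longrightarrow> is_chain r A"
  unfolding is_chain_def L_def by blast

lemma ex_minimal:
  assumes "S \<subseteq> V" "S \<noteq> {}"
  obtains m where "m \<in> S" "\<And>v. v \<in> S \<Longrightarrow> (v, m) \<notin> r"
proof -
  have "finite S" using assms finV finite_subset by blast
  moreover have "acyclic (r\<inverse>)" and "acyclic r" and "finite r"
    using order finV finite_subset[of r "V \<times> V"]
    by (auto simp: strict_order_on_def acyclic_irrefl irrefl_def trancl_id trancl_converse)
  then have "wf r" by (simp add: finite_acyclic_wf)
  ultimately show ?thesis using assms(2) that by (metis wfE_min ex_in_conv)
qed

lemma ex_maximal:
  assumes "S \<subseteq> V" "S \<noteq> {}"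
  obtains m where "m \<in> S" "\<And>v. v \<in> S \<Longrightarrow> (m, v) \<notin> r"
proof -
  have "acyclic r" and "finite r"
    using order finV finite_subset[of r "V \<times> V"]
    by (auto simp: strict_order_on_def acyclic_irrefl irrefl_def trancl_id)
  then have "wf (r\<inverse>)" by (simp add: finite_acyclic_wf_converse)
  then show ?thesis using assms(2) that by (metis wfE_min ex_in_conv converse_iff)
qed

lemma not_L_ne: "V - L \<noteq> {}"
proof -
  obtain A D where o: "(A, D) \<in> occs k V r" using occs_ne by auto
  have "D \<noteq> {}" using occsD(4)[OF o] k2 by auto
  then show ?thesis using not_L_iff o occsD(2)[OF o] by blast
qed

text \<open>A minimal element outside \<open>L\<close> is in some top antichain, and the
  \<open>k\<close>-chain below it can only consist of elements of \<open>L\<close>.\<close>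

lemma k_le_L: "k \<le> card L"
proof -
  obtain h where h: "h \<in> V - L" "\<And>v. v \<in> V - L \<Longrightarrow> (v, h) \<notin> r"
    using ex_minimal[of "V - L"] not_L_ne by blast
  then obtain A D where o: "(A, D) \<in> occs k V r" "h \<in> D" using not_L_iff by blast
  then have "A \<subseteq> L" using h(2) occsD(1,7)[OF o(1)] by blast
  then show ?thesis using occsD(3)[OF o(1)] fin_L card_mono by blast
qed

section \<open>Incomparability is transitive in a maximal order\<close>

lemma incomp_not_L:
  assumes "x \<in> V" "y \<in> V" "x \<noteq> y" "incomp x y"
  shows "x \<in> V - L"
  using assms by (auto simp: L_def)

text \<open>Suppose \<open>x\<close> is below \<open>z\<close> and \<open>y\<close> is incomparable
  to both. If \<open>x\<close> is the top of a \<open>k\<close>-chain lying below an antichain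
  through \<open>z\<close>, making \<open>y\<close> a twin of \<open>z\<close> puts \<open>y\<close>
  above \<open>x\<close>, a contradiction. The work lies in finding that antichain.\<close>

lemma not_less_of_incomp:
  assumes V: "x \<in> V" "y \<in> V" "z \<in> V" and xy: "incomp x y" and yz: "incomp y z"
  shows "(x, z) \<notin> r"
proof
  assume xz: "(x, z) \<in> r"
  have ne: "x \<noteq> y" "y \<noteq> z" using xz xy yz by auto
  have H: "x \<in> V - L" "z \<in> V - L"
    using incomp_not_L[of x y] incomp_not_L[of z y] V xy yz ne by auto
  obtain A0 D where o: "(A0, D) \<in> occs k V r" "z \<in> D" using H(2) not_L_iff by blast
  note o' = occsD[OF o(1)]
  have fD: "finite D" using o'(2) finV finite_subset by blast
  have cD: "card (D - {v}) = k - 1" if "v \<in> D" for v using that o'(4) fD by simp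
  have "k - 2 \<le> card (D - {z})" using cD[OF o(2)] by simp
  \<comment> \<open>Together with \<open>z\<close> and one twin, \<open>E\<close> has to make
    exactly \<open>k\<close> elements, hence \<open>k - 2\<close>.\<close>
  then obtain E where E: "E \<subseteq> D - {z}" "card E = k - 2"
    by (metis obtain_subset_with_card_n)
  \<comment> \<open>If \<open>x\<close> is not below \<open>e\<close>, the two are incomparable,
    because \<open>e\<close> below \<open>x\<close> would give \<open>e\<close> below
    \<open>z\<close>. Twinning \<open>e\<close> with \<open>x\<close>, while keeping
    \<open>z\<close> in the antichain, then makes \<open>x\<close> incomparable to
    \<open>z\<close>.\<close>
  have xE: "(x, e) \<in> r" if e: "e \<in> E" for e
  proof (rule ccontr)
    assume "(x, e) \<notin> r"
    have eD: "e \<in> D" "e \<noteq> z" using e E by auto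
    have ez: "incomp e z" using eD o o'(6) by (auto simp: is_antichain_def)
    have ex: "incomp e x" "e \<noteq> x"
      using ez xz \<open>(x, e) \<notin> r\<close> r_trans by blast+
    have fE: "finite E" using E fD finite_subset by blast
    have "card (insert z (E - {e})) = k - 2"
      using E fE e by (metis (no_types, lifting) DiffD1 DiffD2 card_Suc_Diff1 card_insert_disjoint finite_Diff insertI1 subsetD)
    have "incomp z x"
    proof (rule twin_extend(2)[of e x A0 "insert z (E - {e})"])
      show "is_antichain r (insert e (insert z (E - {e})))"
        using o'(6) by (rule is_antichain_subset) (use E eD o in auto)
      show "x \<notin> insert z (E - {e})"
      proof
        assume "x \<in> insert z (E - {e})"
        then have "x \<in> D" using E o by auto
        then show False using o(2) o'(6) xz by (auto simp: is_antichain_def)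
      qed
      show "(a, d) \<in> r" if "a \<in> A0" "d \<in> insert e (insert z (E - {e}))" for a d
        using that E eD o o'(7) by blast
    qed (use \<open>card (insert z (E - {e})) = k - 2\<close> ex eD V o o' E in auto)
    then show False using xz by blast
  qed
  \<comment> \<open>Since \<open>x\<close> is outside \<open>L\<close>, any \<open>k - 1\<close>
    elements of \<open>L\<close> lie below it and complete it to a \<open>k\<close>-chain.\<close>
  obtain A1 where A1: "A1 \<subseteq> L" "card A1 = k - 1"
    by (metis diff_le_self k_le_L le_trans obtain_subset_with_card_n)
  have fA1: "finite A1" using A1 fin_L finite_subset by blast
  have "(x, y) \<in> r"
  proof (rule twin_extend(1)[of z y "insert x A1" E])
    show "card (insert x A1) = k" using A1 H(1) fA1 k2 by (subst card_insert_disjoint) auto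
    show "is_chain r (insert x A1)"
      using A1(1) is_chain_L[OF A1(1)] L_below H(1) by (auto simp: is_chain_def)
    show "is_antichain r (insert z E)" using o'(6) by (rule is_antichain_subset) (use E o in auto)
    show "y \<notin> E" using xE xy by blast
    show "(a, e) \<in> r" if "a \<in> insert x A1" "e \<in> insert z E" for a e
      using that xE xz r_trans A1(1) L_below H(1) by blast
  qed (use V yz ne E A1 L_V o'(2) in auto)
  then show False using xy by simp
qed

section \<open>Incomparability classes as layers\<close>

definition cls :: "'a \<Rightarrow> 'a set" where
  "cls v = {u \<in> V. incomp u v}"

lemma cls_V: "cls v \<subseteq> V" by (auto simp: cls_def)

lemma fin_cls: "finite (cls v)" using cls_V finV finite_subset by blast

lemma self_cls: "v \<in> V \<Longrightarrow> v \<in> cls v" by (simp add: cls_def r_irrefl)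

lemma incomp_trans: "x \<in> V \<Longrightarrow> y \<in> V \<Longrightarrow> z \<in> V \<Longrightarrow> incomp x y \<Longrightarrow> incomp y z \<Longrightarrow> incomp x z"
  using not_less_of_incomp by metis

lemma cls_incomp: "v \<in> V \<Longrightarrow> a \<in> cls v \<Longrightarrow> b \<in> cls v \<Longrightarrow> incomp a b"
  using incomp_trans[of a v b] by (auto simp: cls_def)

text \<open>Otherwise \<open>u\<close> would be incomparable to \<open>a\<close>, hence to
  \<open>v\<close> by transitivity of incomparability.\<close>

lemma cls_below:
  assumes "v \<in> V" "a \<in> cls v" "(u, v) \<in> r" shows "(u, a) \<in> r"
proof (rule ccontr)
  assume n: "(u, a) \<notin> r"
  have "u \<in> V" using r_V assms by blast
  moreover have "(a, u) \<notin> r" using assms r_trans by (auto simp: cls_def)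
  ultimately show False using incomp_trans[of u a v] n assms by (auto simp: cls_def)
qed

lemma cls_above:
  assumes "v \<in> V" "a \<in> cls v" "(v, u) \<in> r" shows "(a, u) \<in> r"
proof (rule ccontr)
  assume n: "(a, u) \<notin> r"
  have "u \<in> V" using r_V assms by blast
  moreover have "(u, a) \<notin> r" using assms r_trans by (auto simp: cls_def)
  ultimately show False using incomp_trans[of v a u] n assms by (auto simp: cls_def)
qed

lemma antichain_cls:
  assumes "is_antichain r D" "D \<subseteq> V" "d \<in> D" "d \<in> cls v" "v \<in> V"
  shows "D \<subseteq> cls v"
proof
  fix e assume "e \<in> D"
  then have "incomp e d" "e \<in> V" "d \<in> V" using assms by (auto simp: is_antichain_def)
  then show "e \<in> cls v" using incomp_trans[of e d v] assms by (auto simp: cls_def)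
qed

text \<open>A top antichain through \<open>v\<close> lies entirely in the class of
  \<open>v\<close>.\<close>

lemma k_le_cls:
  assumes "v \<in> V - L" shows "k \<le> card (cls v)"
proof -
  obtain A D where o: "(A, D) \<in> occs k V r" "v \<in> D" using assms not_L_iff by blast
  then have "D \<subseteq> cls v" using antichain_cls[of D v v] assms occsD(2,6)[OF o(1)] self_cls by blast
  then show ?thesis using occsD(4)[OF o(1)] fin_cls card_mono by metis
qed

end

section \<open>The layers of a maximal order\<close>

lemma choose_less:
  fixes m n k :: nat
  assumes "m < n" "k \<le> n" "k \<ge> 1"
  shows "m choose k < n choose k"
proof -
  obtain n' j where n: "n = Suc n'" and k: "k = Suc j"
    using assms by (metis Suc_le_D less_imp_Suc_add One_nat_def)
  have "m choose k \<le> n' choose k" using assms n by (intro binomial_right_mono) auto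
  moreover have "0 < n' choose j" using assms n k by simp
  ultimately show ?thesis unfolding n k binomial_Suc_Suc by linarith
qed

text \<open>The ratio of neighbouring binomial coefficients reduces the comparison of lost and new
  occurrences to that of linear factors.\<close>

lemma choose_step:
  fixes n k :: nat
  assumes "k \<ge> 1"
  shows "k * (n choose k) = (n - (k - 1)) * (n choose (k - 1))"
  using assms binomial_absorption[of "k - 1" n] binomial_absorb_comp[of n "k - 1"] by simp

context optimal_order
begin

section \<open>Merging the two top layers\<close>

definition chains :: "nat \<Rightarrow> 'a set \<Rightarrow> 'a set set" where
  "chains j B = {A. A \<subseteq> B \<and> card A = j \<and> is_chain r A}"

lemma fin_chains: "finite B \<Longrightarrow> finite (chains j B)"
  by (rule finite_subset[of _ "Pow B"]) (auto simp: chains_def)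

text \<open>Double counting of \<open>k\<close>-chains with a marked element: any element of
  \<open>L\<close> extends a chain not containing it, and a \<open>k\<close>-chain admits
  \<open>k\<close> marks.\<close>

lemma chains_extend:
  assumes B: "B \<subseteq> V"
  shows "(card (L \<inter> B) - (k - 1)) * card (chains (k - 1) B) \<le> k * card (chains k B)"
proof -
  have finB: "finite B" using B finV finite_subset by blast
  define P where "P = Sigma (chains (k - 1) B) (\<lambda>A. L \<inter> B - A)"
  define Q where "Q = Sigma (chains k B) (\<lambda>A. A)"
  define f where "f = (\<lambda>(A, v :: 'a). (insert v A, v))"
  have finA: "finite A" if "A \<in> chains j B" for A j
    using that finB finite_subset by (auto simp: chains_def)
  have "inj_on f P"
    by (auto simp: inj_on_def f_def P_def insert_ident)
  moreover have "f ` P \<subseteq> Q"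
  proof (clarsimp simp: f_def P_def Q_def simp del: One_nat_def)
    fix A v assume A: "A \<in> chains (k - 1) B" and v: "v \<in> L" "v \<in> B" "v \<notin> A"
    have "is_chain r (insert v A)"
      using A v B by (auto simp: chains_def is_chain_def L_def subset_iff)
    moreover have "card (insert v A) = k" using A v finA[OF A] k2 by (simp add: chains_def)
    ultimately show "insert v A \<in> chains k B" using A v by (auto simp: chains_def)
  qed
  moreover have "finite Q" unfolding Q_def using fin_chains finA finB by blast
  ultimately have "card P \<le> card Q" using card_inj_on_le by blast
  moreover have "card Q = k * card (chains k B)"
  proof -
    have "card Q = (\<Sum>A\<in>chains k B. card A)"
      unfolding Q_def using fin_chains finA finB by (intro card_SigmaI) auto
    also have "\<dots> = (\<Sum>A\<in>chains k B. k)" by (intro sum.cong) (auto simp: chains_def)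
    finally show ?thesis by simp
  qed
  moreover have "(card (L \<inter> B) - (k - 1)) * card (chains (k - 1) B) \<le> card P"
  proof -
    have "(\<Sum>A\<in>chains (k - 1) B. card (L \<inter> B) - (k - 1)) \<le> (\<Sum>A\<in>chains (k - 1) B. card (L \<inter> B - A))"
    proof (rule sum_mono)
      fix A assume A: "A \<in> chains (k - 1) B"
      then show "card (L \<inter> B) - (k - 1) \<le> card (L \<inter> B - A)"
        using diff_card_le_card_Diff[OF finA[OF A], of "L \<inter> B"] by (simp add: chains_def)
    qed
    also have "\<dots> = card P"
      unfolding P_def using fin_chains finB by (intro card_SigmaI[symmetric]) auto
    finally show ?thesis by (simp add: mult.commute)
  qed
  ultimately show ?thesis by linarith
qed

lemma top_above:
  assumes "y \<in> V" "\<And>v. (y, v) \<notin> r" "v \<in> V - cls y" "u \<in> cls y"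
  shows "(v, u) \<in> r"
proof -
  have "(v, y) \<in> r" using assms by (auto simp: cls_def)
  then show ?thesis using cls_below assms by blast
qed

lemma cls_sym: "v \<in> V \<Longrightarrow> u \<in> cls v \<Longrightarrow> v \<in> cls u"
  by (simp add: cls_def)

lemma top_maximal:
  assumes "y \<in> V" "\<And>v. (y, v) \<notin> r" "u \<in> cls y"
  shows "(u, v) \<notin> r"
  using assms cls_above[of u y v] cls_sym[of y u] cls_V by blast

lemma cls_disjoint_L:
  assumes "v \<in> V" "v \<notin> L" shows "cls v \<inter> L = {}"
proof (rule equals0I)
  fix u assume "u \<in> cls v \<inter> L"
  then have "incomp u v" "u \<in> L" "u \<noteq> v" using assms by (auto simp: cls_def)
  then show False using assms(1) by (auto simp: L_def)
qed

lemma top_not_L: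
  assumes "y \<in> V" "\<And>v. (y, v) \<notin> r"
  shows "y \<notin> L" and "cls y \<inter> L = {}"
proof -
  show "y \<notin> L" using not_L_ne L_below assms by blast
  then show "cls y \<inter> L = {}" using assms(1) by (rule cls_disjoint_L[rotated])
qed

text \<open>\<open>cls y\<close> is the top layer and \<open>cls w\<close> the one directly below
  it, possibly a single element of \<open>L\<close>. Merging destroys occurrences whose chain uses
  \<open>cls w\<close> and creates antichains that mix the two layers; the inequality bounds the
  former from above and the latter from below.\<close>

lemma merge:
  assumes y: "y \<in> V" "\<And>v. (y, v) \<notin> r"
    and w: "w \<in> V - cls y" "\<And>v. v \<in> V - cls y \<Longrightarrow> (w, v) \<notin> r"
  obtains s where "strict_order_on V s" "s \<subseteq> r" "\<And>u. u \<in> cls w \<Longrightarrow> (u, y) \<notin> s"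
    "card (occs k V r) + card (chains k (V - cls y - cls w)) * card (cls w) * (card (cls y) choose (k - 1))
      \<le> card (occs k V s) + card (chains (k - 1) (V - cls y - cls w)) * card (cls w) * (card (cls y) choose k)"
proof -
  define Y W B where YWB: "Y = cls y" "W = cls w" "B = V - cls y - cls w"
  \<comment> \<open>Giving every element of \<open>W\<close> the comparabilities of \<open>y\<close>
    removes exactly the pairs in \<open>W \<times> Y\<close>; this is \<open>s_iff\<close>.\<close>
  define s where "s = pull V (\<lambda>v. if v \<in> W then y else v) r"
  have V: "w \<in> V" "Y \<subseteq> V" "W \<subseteq> V" "B \<subseteq> V" using w(1) cls_V by (auto simp: YWB)
  have fin: "finite Y" "finite W" "finite B" using V finV finite_subset by blast+
  have YW: "Y \<inter> W = {}"
  proof (rule ccontr)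
    assume "Y \<inter> W \<noteq> {}"
    then obtain u where u: "u \<in> cls y" "u \<in> cls w" by (auto simp: YWB)
    then have "w \<in> cls y" using incomp_trans[of w u y] y(1) V(1) by (auto simp: cls_def)
    then show False using w(1) by simp
  qed
  have above: "(v, u) \<in> r" if "v \<in> V - Y" "u \<in> Y" for u v
    using top_above[OF y] that by (simp add: YWB)
  have maxY: "(u, v) \<notin> r" if "u \<in> Y" for u v
    using top_maximal[OF y] that by (simp add: YWB)
  have WY: "v \<in> Y" if "u \<in> W" "(u, v) \<in> r" for u v
  proof (rule ccontr)
    assume "v \<notin> Y"
    then have "v \<in> V - cls y" using r_V[OF that(2)] by (simp add: YWB)
    moreover have "(w, v) \<in> r"
      using that cls_above[of u w v] cls_sym[of w u] V by (auto simp: YWB)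
    ultimately show False using w(2) by blast
  qed
  have BW: "(v, u) \<in> r" if "v \<in> B" "u \<in> W" for u v
  proof -
    have "(v, w) \<in> r" using that(1) w(2) by (auto simp: YWB cls_def)
    then show ?thesis using cls_below that(2) V by (auto simp: YWB)
  qed
  have WW: "(a, b) \<notin> r" if "a \<in> W" "b \<in> W" for a b
    using that cls_incomp V by (auto simp: YWB)
  have s_iff: "(a, b) \<in> s \<longleftrightarrow> (a, b) \<in> r \<and> \<not> (a \<in> W \<and> b \<in> Y)" for a b
  proof (cases "a \<in> V \<and> b \<in> V")
    case True
    have yY: "y \<in> Y" using self_cls y(1) by (simp add: YWB)
    consider "a \<in> W" | "a \<notin> W" "b \<in> W" | "a \<notin> W" "b \<notin> W" by blast
    then show ?thesis
    proof cases
      case 1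
      then show ?thesis using y(2) WY by (auto simp: s_def pull_def)
    next
      case 2
      show ?thesis
      proof (cases "a \<in> Y")
        case True
        then show ?thesis using 2 maxY by (auto simp: s_def pull_def)
      next
        case False
        then have "(a, y) \<in> r" "(a, b) \<in> r"
          using above[of a y] BW[of a b] 2 True yY by (auto simp: YWB)
        then show ?thesis using 2 True by (auto simp: s_def pull_def)
      qed
    next
      case 3
      then show ?thesis using True by (auto simp: s_def pull_def)
    qed
  qed (use r_V in \<open>auto simp: s_def pull_def\<close>)
  \<comment> \<open>A chain meets the antichain \<open>W\<close> at most once. If it does below an
    antichain \<open>D\<close>, then \<open>D\<close> lies in \<open>Y\<close> and the remaining
    \<open>k - 1\<close> chain elements in \<open>B\<close>.\<close>
  define lost where "lost = (\<lambda>((A, w), D). (insert w A, D)) `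
    ((chains (k - 1) B \<times> W) \<times> {D. D \<subseteq> Y \<and> card D = k})"
  \<comment> \<open>Only mixed antichains with a single element of \<open>W\<close> are counted, so
    that gain and loss share the factor \<open>card W\<close>.\<close>
  define new where "new = (\<lambda>((A, w), E). (A, insert w E)) `
    ((chains k B \<times> W) \<times> {E. E \<subseteq> Y \<and> card E = k - 1})"
  have fsub: "finite {D. D \<subseteq> Y \<and> card D = j}" for j using fin by simp
  have finl: "finite lost" unfolding lost_def using fin fin_chains fsub by blast
  have "card lost \<le> card ((chains (k - 1) B \<times> W) \<times> {D. D \<subseteq> Y \<and> card D = k})"
    unfolding lost_def using fin fin_chains fsub by (intro card_image_le) blast
  then have cl: "card lost \<le> card (chains (k - 1) B) * card W * (card Y choose k)"
    using n_subsets[OF fin(1)] by (simp add: card_cartesian_product)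
  have "inj_on (\<lambda>((A, w), E). (A, insert w E))
      ((chains k B \<times> W) \<times> {E. E \<subseteq> Y \<and> card E = k - 1})"
  proof (rule inj_onI, clarsimp)
    fix w E w' E'
    assume h: "w \<in> W" "E \<subseteq> Y" "w' \<in> W" "E' \<subseteq> Y" and eq: "insert w E = insert w' E'"
    have "w \<notin> Y" "w' \<notin> Y" using h YW by auto
    moreover from this have "w = w'" using h eq by blast
    ultimately show "w = w' \<and> E = E'" using h eq insert_ident by (metis subsetD)
  qed
  then have cn: "card new = card (chains k B) * card W * (card Y choose (k - 1))"
    unfolding new_def using n_subsets[OF fin(1)] by (simp add: card_image card_cartesian_product)
  have keep: "occs k V r - lost \<subseteq> occs k V s"
  proof
    fix p assume p: "p \<in> occs k V r - lost"
    obtain A D where pAD: "p = (A, D)" by (cases p)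
    have AD: "(A, D) \<in> occs k V r" using p pAD by simp
    note o = occsD[OF AD]
    have finA: "finite A" using o(1) finV finite_subset by blast
    have AW: "A \<inter> W = {}"
    proof (rule ccontr)
      assume "A \<inter> W \<noteq> {}"
      then obtain u where u: "u \<in> A" "u \<in> W" by blast
      have DY: "D \<subseteq> Y" using WY[OF u(2)] o(7)[OF u(1)] by blast
      have "D \<noteq> {}" using o(4) k2 by auto
      then have "A \<inter> Y = {}" using o(7) maxY by blast
      moreover have "a \<notin> W" if "a \<in> A" "a \<noteq> u" for a
        using that u o(5) WW unfolding is_chain_def by blast
      ultimately have "A - {u} \<subseteq> B" using o(1) unfolding YWB by blast
      then have "A - {u} \<in> chains (k - 1) B"
        using u o(3) finA is_chain_subset[OF o(5), of "A - {u}"] by (auto simp: chains_def)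
      then have "((A - {u}, u), D) \<in> (chains (k - 1) B \<times> W) \<times> {D. D \<subseteq> Y \<and> card D = k}"
        using u DY o(4) by simp
      then have "(insert u (A - {u}), D) \<in> lost" unfolding lost_def by (rule rev_image_eqI) simp
      then show False using p u pAD by (simp add: insert_absorb)
    qed
    have "(A, D) \<in> occs k V s"
    proof (rule occsI)
      show "is_chain s A" using o(5) AW unfolding is_chain_def s_iff by blast
      show "is_antichain s D" using o(6) unfolding is_antichain_def s_iff by blast
      show "(a, d) \<in> s" if "a \<in> A" "d \<in> D" for a d using that o(7) AW unfolding s_iff by blast
    qed fact+
    then show "p \<in> occs k V s" using pAD by simp
  qed
  have newD: "\<exists>A w E. p = (A, insert w E) \<and> A \<in> chains k B \<and> w \<in> W \<and> E \<subseteq> Y \<and> card E = k - 1"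
    if "p \<in> new" for p
    using that unfolding new_def by auto
  have new_s: "new \<subseteq> occs k V s"
  proof
    fix p assume "p \<in> new"
    from newD[OF this] obtain A u E where p: "p = (A, insert u E)" and A: "A \<in> chains k B"
      and u: "u \<in> W" and E: "E \<subseteq> Y" "card E = k - 1" by blast
    have fE: "finite E" using E fin finite_subset by blast
    have "(A, insert u E) \<in> occs k V s"
    proof (rule occsI)
      have "u \<notin> E" using u E YW by blast
      then show "card (insert u E) = k" using E fE k2 by simp
      show "A \<subseteq> V" "card A = k" using A V by (auto simp: chains_def)
      show "insert u E \<subseteq> V" using u E V by blast
      have AB: "A \<subseteq> B" using A by (simp add: chains_def)
      then have AW: "A \<inter> W = {}" "A \<subseteq> V - Y" by (auto simp: YWB)
      show "is_chain s A" using A AW unfolding chains_def is_chain_def s_iff by blast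
      show "is_antichain s (insert u E)"
        using u E maxY r_irrefl unfolding is_antichain_def s_iff by blast
      show "(a, d) \<in> s" if "a \<in> A" "d \<in> insert u E" for a d
        using that AB AW above BW u E unfolding s_iff by blast
    qed
    then show "p \<in> occs k V s" using p by simp
  qed
  have new_r: "new \<inter> occs k V r = {}"
  proof (rule ccontr)
    assume "new \<inter> occs k V r \<noteq> {}"
    then obtain p where p: "p \<in> new" "p \<in> occs k V r" by blast
    from newD[OF p(1)] obtain A u E where q: "p = (A, insert u E)"
      and u: "u \<in> W" and E: "E \<subseteq> Y" "card E = k - 1" by blast
    have "E \<noteq> {}" using E(2) k2 by auto
    then obtain e where "e \<in> E" by blast
    moreover from this have "(u, e) \<in> r" using above u E V YW by blast
    ultimately show False using p(2) q occsD(6) unfolding is_antichain_def by blast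
  qed
  have ineq: "card (occs k V r) + card new \<le> card (occs k V s) + card lost"
    by (rule exchange_card[OF finV finl keep new_s new_r])
  show ?thesis
  proof (rule that)
    show "strict_order_on V s" unfolding s_def by (rule strict_order_on_pull[OF order])
    show "s \<subseteq> r" using s_iff by auto
    show "(u, y) \<notin> s" if "u \<in> cls w" for u
      using that self_cls[OF y(1)] by (simp add: s_iff YWB)
  qed (use ineq cl cn in \<open>simp add: YWB\<close>)
qed

text \<open>With \<open>B = V - cls y - cls w\<close> and \<open>c = card (cls y)\<close>,
  \<open>merge\<close> weighs \<open>k\<close>-chains in \<open>B\<close> times
  \<open>c choose (k - 1)\<close> against \<open>(k - 1)\<close>-chains in \<open>B\<close> times
  \<open>c choose k\<close>. By \<open>chains_extend\<close> and \<open>choose_step\<close>, merging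
  gains if \<open>b > c\<close> and loses nothing if \<open>b \<ge> c\<close>.\<close>

lemma merge_optimal:
  assumes y: "y \<in> V" "\<And>v. (y, v) \<notin> r"
    and w: "w \<in> V - cls y" "\<And>v. v \<in> V - cls y \<Longrightarrow> (w, v) \<notin> r"
  defines "b \<equiv> card (L \<inter> (V - cls y - cls w))"
  shows "b \<le> card (cls y)"
    and "card (cls y) \<le> b \<Longrightarrow> \<exists>s. strict_order_on V s \<and> s \<subseteq> r \<and> (\<forall>u\<in>cls w. (u, y) \<notin> s) \<and>
      card (occs k V r) \<le> card (occs k V s)"
proof -
  define B where "B = V - cls y - cls w"
  define c where "c = card (cls y)"
  define e e' where "e = card (chains k B)" and "e' = card (chains (k - 1) B)"
  define cw where "cw = card (cls w)"
  obtain s where s: "strict_order_on V s" "s \<subseteq> r" "\<And>u. u \<in> cls w \<Longrightarrow> (u, y) \<notin> s"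
    and ineq: "card (occs k V r) + e * cw * (c choose (k - 1)) \<le> card (occs k V s) + e' * cw * (c choose k)"
    using merge[OF y w] unfolding B_def c_def e_def e'_def cw_def by blast
  have B: "B \<subseteq> V" by (auto simp: B_def)
  have ext: "(b - (k - 1)) * e' \<le> k * e"
    using chains_extend[OF B] by (simp add: b_def B_def e_def e'_def)
  have kc: "k \<le> c" unfolding c_def using k_le_cls[of y] top_not_L(1)[OF y] y(1) by blast
  have step: "k * (c choose k) = (c - (k - 1)) * (c choose (k - 1))"
    using k2 by (intro choose_step) simp
  have "k * (e' * cw * (c choose k)) = (c - (k - 1)) * (e' * cw * (c choose (k - 1)))"
    using step by (metis mult.assoc mult.commute)
  moreover have "(b - (k - 1)) * (e' * cw * (c choose (k - 1))) \<le> k * (e * cw * (c choose (k - 1)))"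
    using mult_le_mono1[OF ext, of "cw * (c choose (k - 1))"] by (simp add: mult.assoc)
  \<comment> \<open>Scaled by \<open>k\<close>, the loss is \<open>c - (k - 1)\<close> times a
    common product and the gain at least \<open>b - (k - 1)\<close> times the same product.\<close>
  ultimately have main: "k * (e' * cw * (c choose k)) +
      (b - (k - 1)) * (e' * cw * (c choose (k - 1))) \<le>
      (c - (k - 1)) * (e' * cw * (c choose (k - 1))) + k * (e * cw * (c choose (k - 1)))"
    by linarith
  show "b \<le> card (cls y)"
  proof (rule ccontr)
    assume "\<not> b \<le> card (cls y)"
    then have cb: "c < b" by (simp add: c_def)
    \<comment> \<open>A strict gain needs the common product to be nonzero:
      \<open>L \<inter> B\<close> supplies a chain of \<open>k - 1\<close> elements, and
      \<open>w\<close> lies in its own class.\<close>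
    have "k - 1 \<le> card (L \<inter> B)" using cb kc by (simp add: b_def B_def)
    then obtain A where A: "A \<subseteq> L \<inter> B" "card A = k - 1" by (metis obtain_subset_with_card_n)
    then have "A \<in> chains (k - 1) B" using is_chain_L by (auto simp: chains_def)
    moreover have "finite (chains (k - 1) B)"
      by (rule fin_chains) (use B finV finite_subset in blast)
    ultimately have "e' > 0" by (auto simp: e'_def card_gt_0_iff)
    moreover have "cw > 0"
      using self_cls[of w] w(1) fin_cls by (auto simp: cw_def card_gt_0_iff)
    moreover have "(c choose (k - 1)) > 0" using kc by simp
    ultimately have "e' * cw * (c choose (k - 1)) > 0" by simp
    moreover have "c - (k - 1) < b - (k - 1)" using cb kc by linarith
    ultimately have "(c - (k - 1)) * (e' * cw * (c choose (k - 1))) < (b - (k - 1)) * (e' * cw * (c choose (k - 1)))"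
      by simp
    then have "k * (e' * cw * (c choose k)) < k * (e * cw * (c choose (k - 1)))"
      using main by linarith
    then have "e' * cw * (c choose k) < e * cw * (c choose (k - 1))" by simp
    then show False using ineq optimal[OF s(1)] by linarith
  qed
  assume "card (cls y) \<le> b"
  then have "c - (k - 1) \<le> b - (k - 1)" by (simp add: c_def)
  then have "(c - (k - 1)) * (e' * cw * (c choose (k - 1))) \<le> (b - (k - 1)) * (e' * cw * (c choose (k - 1)))"
    by (rule mult_le_mono1)
  then have "k * (e' * cw * (c choose k)) \<le> k * (e * cw * (c choose (k - 1)))"
    using main by linarith
  then have "e' * cw * (c choose k) \<le> e * cw * (c choose (k - 1))" using k2 by simp
  then have "card (occs k V r) \<le> card (occs k V s)" using ineq by linarith
  then show "\<exists>s. strict_order_on V s \<and> s \<subseteq> r \<and> (\<forall>u\<in>cls w. (u, y) \<notin> s) \<and>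
      card (occs k V r) \<le> card (occs k V s)" using s by blast
qed

text \<open>Let \<open>X\<close> be the lowest layer outside \<open>L\<close> and \<open>Y\<close>
  the top one. Making \<open>X\<close> a chain at the bottom loses at most the pairs of
  \<open>k\<close>-sets from \<open>L\<close> and \<open>X\<close>, and gains those from
  \<open>X\<close> and \<open>Y\<close>. Optimality then compares \<open>card Y choose k\<close>
  with \<open>card L choose k\<close>.\<close>

lemma top_card_le:
  assumes y: "y \<in> V" "\<And>v. (y, v) \<notin> r" and ne: "V - cls y - L \<noteq> {}"
  shows "card (cls y) \<le> card L"
proof -
  obtain x where x: "x \<in> V - L" "\<And>v. v \<in> V - L \<Longrightarrow> (v, x) \<notin> r"
    using ex_minimal[of "V - L"] not_L_ne by blast
  define X Y where XY: "X = cls x" "Y = cls y"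
  have V: "x \<in> V" "X \<subseteq> V" "Y \<subseteq> V" using x(1) cls_V by (auto simp: XY)
  have fin: "finite X" "finite Y" using V finV finite_subset by blast+
  obtain h where h: "h \<in> V - cls y" "h \<in> V - L" using ne by blast
  have xy: "x \<notin> cls y" using top_above[OF y h(1)] x(2)[OF h(2)] by blast
  have XYd: "X \<inter> Y = {}"
  proof (rule ccontr)
    assume "X \<inter> Y \<noteq> {}"
    then obtain u where u: "u \<in> cls x" "u \<in> cls y" by (auto simp: XY)
    then have "x \<in> cls y" using incomp_trans[of x u y] y(1) V(1) by (auto simp: cls_def)
    then show False using xy by simp
  qed
  have above: "(v, u) \<in> r" if "v \<in> X" "u \<in> Y" for u v
    using top_above[OF y, of v u] that V XYd by (auto simp: XY)
  \<comment> \<open>\<open>X\<close> is the class of a minimal element outside \<open>L\<close>, so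
    an occurrence with antichain in \<open>X\<close> has its chain in \<open>L\<close>.\<close>
  have below: "v \<in> L" if "u \<in> X" "(v, u) \<in> r" for u v
  proof -
    have "(v, x) \<in> r" using cls_below[of u x v] that cls_sym[of x u] V by (auto simp: XY)
    then show ?thesis using x(2) r_V[OF that(2)] by blast
  qed
  let ?s = "chain_below V X r"
  define S where "S = (\<lambda>T :: 'a set. {A. A \<subseteq> T \<and> card A = k})"
  have cS: "card (S T) = card T choose k" "finite (S T)" if "finite T" for T
    using n_subsets[OF that] that by (auto simp: S_def)
  have "card (S X \<times> S Y) \<le> card (S L \<times> S X)"
  proof (rule exchange_le[of ?s])
    show "strict_order_on V ?s" by (rule strict_order_on_chain_below[OF order])
    show "finite (S L \<times> S X)" using cS fin fin_L by simp
    show "occs k V r - S L \<times> S X \<subseteq> occs k V ?s"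
    proof (rule subrelI)
      fix A D assume "(A, D) \<in> occs k V r - S L \<times> S X"
      then have o: "(A, D) \<in> occs k V r" and n: "(A, D) \<notin> S L \<times> S X" by blast+
      note o' = occsD[OF o]
      have "D \<inter> X = {}"
      proof (rule ccontr)
        assume "D \<inter> X \<noteq> {}"
        then obtain d where d: "d \<in> D" "d \<in> X" by blast
        have "D \<subseteq> X" using antichain_cls[OF o'(6,2) d(1), of x] d(2) V by (simp add: XY)
        moreover have "A \<subseteq> L" using below[OF d(2)] o'(7) d(1) by blast
        ultimately show False using n o'(3,4) by (simp add: S_def)
      qed
      then show "(A, D) \<in> occs k V ?s" using occs_chain_below o by blast
    qed
    show "S X \<times> S Y \<subseteq> occs k V ?s"
    proof (clarify)
      fix A D assume "A \<in> S X" "D \<in> S Y"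
      then have A: "A \<subseteq> X" "card A = k" and D: "D \<subseteq> Y" "card D = k" by (auto simp: S_def)
      show "(A, D) \<in> occs k V ?s"
      proof (rule occsI)
        show "is_chain ?s A"
          unfolding is_chain_def
        proof (intro ballI impI)
          fix a b assume "a \<in> A" "b \<in> A" "a \<noteq> b"
          then have "a \<in> X" "b \<in> X" "a \<in> V" "b \<in> V" "a < b \<or> b < a" using A V by auto
          then show "(a, b) \<in> ?s \<or> (b, a) \<in> ?s" by (auto simp: chain_below_def)
        qed
        have DX: "D \<inter> X = {}" using D XYd by blast
        have "(a, b) \<notin> r" if "a \<in> D" "b \<in> D" for a b
          using cls_incomp[OF y(1)] that D by (auto simp: XY)
        then show "is_antichain ?s D" using DX by (auto simp: is_antichain_def chain_below_def)
        show "(a, d) \<in> ?s" if "a \<in> A" "d \<in> D" for a d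
          using that A D V DX by (auto simp: chain_below_def)
      qed (use A D V in auto)
    qed
    show "(S X \<times> S Y) \<inter> occs k V r = {}"
    proof -
      have "(A, D) \<notin> occs k V r" if A: "A \<in> S X" for A D
      proof
        assume o: "(A, D) \<in> occs k V r"
        have A: "A \<subseteq> X" "card A = k" using that by (auto simp: S_def)
        then have "finite A" using fin finite_subset by blast
        then obtain a b where "a \<in> A" "b \<in> A" "a \<noteq> b"
          using A(2) k2 by (metis card_le_Suc0_iff_eq not_less_eq_eq numeral_2_eq_2)
        then show False
          using occsD(5)[OF o] cls_incomp[OF V(1), of a b] A(1) unfolding XY is_chain_def by blast
      qed
      then show ?thesis by blast
    qed
  qed
  then have "(card X choose k) * (card Y choose k) \<le> (card L choose k) * (card X choose k)"
    using cS fin fin_L by (simp add: card_cartesian_product)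
  moreover have "(card X choose k) > 0" using k_le_cls[OF x(1)] by (simp add: XY)
  ultimately have "(card Y choose k) \<le> (card L choose k)" by (simp add: mult.commute)
  moreover have "k \<le> card Y" using k_le_cls[of y] top_not_L(1)[OF y] y(1) by (simp add: XY)
  ultimately show ?thesis
    using choose_less[of "card L" "card Y" k] k2 by (fastforce simp: XY)
qed

text \<open>Moving \<open>y\<close> from the single antichain layer to the bottom loses the
  occurrences with \<open>y\<close> in the antichain and gains those with \<open>y\<close> in the
  chain; \<open>choose_step\<close> turns the balance into a bound on sizes.\<close>

lemma card_L_ge:
  assumes y: "y \<in> V" "\<And>v. (y, v) \<notin> r" and V: "V = L \<union> cls y"
  shows "card (cls y) \<le> card L + 1"
proof -
  define Y where "Y = cls y"
  have YV: "Y \<subseteq> V" using cls_V by (simp add: Y_def)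
  have yY: "y \<in> Y" using self_cls y(1) by (simp add: Y_def)
  have fin: "finite Y" using YV finV finite_subset by blast
  have LY: "L \<inter> Y = {}" using top_not_L(2)[OF y] by (auto simp: Y_def)
  have above: "(v, u) \<in> r" if "v \<in> L" "u \<in> Y" for u v
    using top_above[OF y, of v u] that L_V LY by (auto simp: Y_def)
  have incY: "(u, v) \<notin> r" if "u \<in> Y" for u v
    using top_maximal[OF y] that by (simp add: Y_def)
  let ?s = "chain_below V {y} r"
  define S where "S = (\<lambda>j (T :: 'a set). {A. A \<subseteq> T \<and> card A = j})"
  have cS: "card (S j T) = card T choose j" "finite (S j T)" if "finite T" for T j
    using n_subsets[OF that] that by (auto simp: S_def)
  have inj: "inj_on (insert y) (S j T)" if "y \<notin> T" for j T
    using that by (auto simp: inj_on_def S_def insert_ident subset_iff)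
  have yL: "y \<notin> L" using LY yY by blast
  have "card ((insert y ` S (k - 1) L) \<times> S k (Y - {y})) \<le> card (S k L \<times> (insert y ` S (k - 1) (Y - {y})))"
  proof (rule exchange_le[of ?s])
    show "strict_order_on V ?s" by (rule strict_order_on_chain_below[OF order])
    show "finite (S k L \<times> (insert y ` S (k - 1) (Y - {y})))" using cS fin fin_L by simp
    show "occs k V r - S k L \<times> (insert y ` S (k - 1) (Y - {y})) \<subseteq> occs k V ?s"
    proof (rule subrelI)
      fix A D assume "(A, D) \<in> occs k V r - S k L \<times> (insert y ` S (k - 1) (Y - {y}))"
      then have o: "(A, D) \<in> occs k V r"
        and n: "(A, D) \<notin> S k L \<times> (insert y ` S (k - 1) (Y - {y}))" by blast+
      note o' = occsD[OF o]
      have "y \<notin> D"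
      proof
        assume d: "y \<in> D"
        have "D \<subseteq> Y" using antichain_cls[OF o'(6,2) d, of y] yY y by (simp add: Y_def)
        moreover have "A \<subseteq> L" using o'(1,7) d incY V unfolding Y_def by blast
        moreover have "finite D" using o'(2) finV finite_subset by blast
        ultimately have "A \<in> S k L" "D - {y} \<in> S (k - 1) (Y - {y})"
          using o'(3,4) d by (auto simp: S_def)
        moreover have "insert y (D - {y}) = D" using d by blast
        ultimately show False using n by (metis imageI mem_Sigma_iff)
      qed
      then show "(A, D) \<in> occs k V ?s" using occs_chain_below o by blast
    qed
    have *: "A \<subseteq> L \<and> card A = k - 1 \<and> D \<subseteq> Y - {y} \<and> card D = k" if "A \<in> S (k - 1) L" "D \<in> S k (Y - {y})"
      for A D using that by (simp add: S_def)
    show "(insert y ` S (k - 1) L) \<times> S k (Y - {y}) \<subseteq> occs k V ?s"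
    proof clarify
      fix A D assume "A \<in> S (k - 1) L" "D \<in> S k (Y - {y})"
      note AD = *[OF this]
      have fA: "finite A" using AD fin_L finite_subset by blast
      show "(insert y A, D) \<in> occs k V ?s"
      proof (rule occsI)
        show "card (insert y A) = k"
          using AD fA yL k2 by (subst card_insert_disjoint) auto
        show "is_chain ?s (insert y A)"
          unfolding is_chain_def
        proof (intro ballI impI)
          fix a b assume ab: "a \<in> insert y A" "b \<in> insert y A" "a \<noteq> b"
          then have "a \<in> V" "b \<in> V" using AD L_V y(1) by auto
          moreover have "a = y \<or> b = y \<or> (a, b) \<in> r \<or> (b, a) \<in> r"
            using ab is_chain_L[of A] AD by (auto simp: is_chain_def)
          ultimately show "(a, b) \<in> ?s \<or> (b, a) \<in> ?s" using ab(3) by (auto simp: chain_below_def)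
        qed
        show "is_antichain ?s D"
          using AD incY by (auto simp: is_antichain_def chain_below_def)
        show "(a, d) \<in> ?s" if "a \<in> insert y A" "d \<in> D" for a d
        proof -
          have "d \<in> Y" "d \<noteq> y" "d \<in> V" using that AD YV by auto
          moreover have "a = y \<or> (a, d) \<in> r" using that AD above by blast
          ultimately show ?thesis using r_V[of a d] y(1) by (auto simp: chain_below_def)
        qed
      qed (use AD L_V YV y(1) in auto)
    qed
    show "(insert y ` S (k - 1) L \<times> S k (Y - {y})) \<inter> occs k V r = {}"
    proof -
      have "(insert y A, D) \<notin> occs k V r" if "card D = k" for A D
      proof
        assume o: "(insert y A, D) \<in> occs k V r"
        have "D \<noteq> {}" using that k2 by auto
        then show False using occsD(7)[OF o] y(2) by blast
      qed
      then show ?thesis by (auto simp: S_def)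
    qed
  qed
  then have *: "(card L choose (k - 1)) * (card Y - 1 choose k) \<le> (card L choose k) * (card Y - 1 choose (k - 1))"
    using cS fin fin_L inj yL yY by (simp add: card_cartesian_product card_image)
  \<comment> \<open>Here \<open>c\<close> counts the top layer without \<open>y\<close>, which is
    the source of the \<open>+ 1\<close> in the conclusion.\<close>
  define m c where "m = card L" and "c = card Y - 1"
  have km: "k \<le> m" using k_le_L by (simp add: m_def)
  have kY: "k \<le> card Y" using k_le_cls[of y] top_not_L(1)[OF y] y(1) by (simp add: Y_def)
  have "(m choose (k - 1)) * (k * (c choose k)) \<le> (k * (m choose k)) * (c choose (k - 1))"
    using mult_le_mono2[OF *, of k] by (simp add: m_def c_def ac_simps)
  then have "(c - (k - 1)) * ((m choose (k - 1)) * (c choose (k - 1)))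
      \<le> (m - (k - 1)) * ((m choose (k - 1)) * (c choose (k - 1)))"
    using choose_step[of k c] choose_step[of k m] k2 by (simp add: ac_simps)
  moreover have "(m choose (k - 1)) * (c choose (k - 1)) > 0"
  proof -
    have "k - 1 \<le> m" "k - 1 \<le> c" using km kY by (auto simp: c_def)
    then show ?thesis by simp
  qed
  ultimately have "c - (k - 1) \<le> m - (k - 1)" by simp
  then show ?thesis using km kY k2 by (simp add: m_def c_def Y_def)
qed

text \<open>With another layer between \<open>L\<close> and the top, an element of \<open>L\<close>
  would lie below it and could not be maximal outside \<open>cls y\<close>. So the layer merged
  takes nothing from \<open>L\<close>.\<close>

lemma second_layer:
  assumes y: "y \<in> V" "\<And>v. (y, v) \<notin> r" and ne: "V - cls y - L \<noteq> {}"
    and w: "w \<in> V - cls y" "\<And>v. v \<in> V - cls y \<Longrightarrow> (w, v) \<notin> r"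
  shows "L \<inter> (V - cls y - cls w) = L"
proof -
  obtain h where h: "h \<in> V - cls y" "h \<in> V - L" using ne by blast
  have "w \<notin> L" using w(2)[OF h(1)] L_below[OF _ h(2)] by blast
  then have "cls w \<inter> L = {}" using w(1) cls_disjoint_L by blast
  then show ?thesis using top_not_L(2)[OF y] L_V by blast
qed

text \<open>With one antichain layer, the two sizes differ by at most one, since moving a single
  element up or down gains nothing, and parity excludes a difference of one. With several,
  \<open>merge_optimal\<close> and \<open>top_card_le\<close> give the two inequalities.\<close>

lemma card_L_eq:
  assumes ev: "even (card V)" and y: "y \<in> V" "\<And>v. (y, v) \<notin> r"
  shows "card L = card (cls y)"
proof (cases "V - cls y - L = {}")
  case True
  then have V: "V = L \<union> cls y" using L_V cls_V by blast
  have LY: "L \<inter> cls y = {}" using top_not_L(2)[OF y] by blast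
  have sum: "card V = card L + card (cls y)"
    using V card_Un_disjoint[OF fin_L fin_cls LY] by simp
  have "V - cls y = L" using V LY by blast
  moreover have "L \<noteq> {}" using k_le_L k2 by auto
  ultimately obtain w where w: "w \<in> V - cls y" "\<And>v. v \<in> V - cls y \<Longrightarrow> (w, v) \<notin> r"
    using ex_maximal[of "V - cls y"] by blast
  have wL: "w \<in> L" using w(1) V by blast
  \<comment> \<open>The layer below the top is here just the top element of the chain, so merging
    moves one element up.\<close>
  then have "cls w = {w}" using L_V r_irrefl by (auto simp: cls_def L_def)
  then have "L \<inter> (V - cls y - cls w) = L - {w}" using LY L_V by blast
  then have "card L - 1 \<le> card (cls y)"
    using merge_optimal(1)[OF y w] wL fin_L by simp
  moreover have "card (cls y) \<le> card L + 1" by (rule card_L_ge[OF y V])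
  ultimately have "card L = card (cls y) \<or> card L = card (cls y) + 1 \<or> card (cls y) = card L + 1"
    by linarith
  then show ?thesis using ev sum by auto
next
  case False
  obtain w where w: "w \<in> V - cls y" "\<And>v. v \<in> V - cls y \<Longrightarrow> (w, v) \<notin> r"
    using ex_maximal[of "V - cls y"] False by blast
  have "card L \<le> card (cls y)"
    using merge_optimal(1)[OF y w] second_layer[OF y False w] by simp
  then show ?thesis using top_card_le[OF y False] by simp
qed

end

text \<open>If there were a third layer, merging the two top layers would again be optimal, but then the
  new top layer would be larger than \<open>L\<close>.\<close>

lemma (in optimal_order) two_layers:
  assumes ev: "even (card V)" and y: "y \<in> V" "\<And>v. (y, v) \<notin> r"
  shows "V = L \<union> cls y"
proof (rule ccontr)
  assume "V \<noteq> L \<union> cls y"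
  then have ne: "V - cls y - L \<noteq> {}" using L_V cls_V by blast
  obtain w where w: "w \<in> V - cls y" "\<And>v. v \<in> V - cls y \<Longrightarrow> (w, v) \<notin> r"
    using ex_maximal[of "V - cls y"] ne by blast
  have "card (cls y) \<le> card (L \<inter> (V - cls y - cls w))"
    using second_layer[OF y ne w] card_L_eq[OF ev y] by simp
  then obtain s where s: "strict_order_on V s" "s \<subseteq> r" "\<forall>u\<in>cls w. (u, y) \<notin> s"
    and ge: "card (occs k V r) \<le> card (occs k V s)"
    using merge_optimal(2)[OF y w] by blast
  have pos: "card (occs k V r) > 0" using occs_ne finite_occs[OF finV] by (simp add: card_gt_0_iff)
  \<comment> \<open>The merged order counts at least as many occurrences, so it is maximal as well
    and has equal sizes too.\<close>
  interpret S: optimal_order k V s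
  proof
    show "occs k V s \<noteq> {}" using pos ge by auto
    show "card (occs k V t) \<le> card (occs k V s)" if "strict_order_on V t" for t
      using optimal[OF that] ge by simp
  qed (use k2 finV s in auto)
  have "card S.L = card (S.cls y)" using S.card_L_eq[OF ev y(1)] y(2) s(2) by blast
  \<comment> \<open>Removing comparabilities cannot enlarge \<open>L\<close>, whereas the class of
    \<open>y\<close> gains \<open>w\<close>.\<close>
  moreover have "S.L \<subseteq> L" using s(2) by (auto simp: S.L_def L_def)
  then have "card S.L \<le> card L" using fin_L card_mono by blast
  moreover have "insert w (cls y) \<subseteq> S.cls y"
    using s(2,3) w(1) y self_cls[of w] by (auto simp: S.cls_def cls_def)
  then have "card (insert w (cls y)) \<le> card (S.cls y)" using S.fin_cls card_mono by blast
  moreover have "card (insert w (cls y)) = Suc (card (cls y))" using w(1) fin_cls by simp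
  ultimately show False using card_L_eq[OF ev y] by simp
qed

section \<open>Shape and number of occurrences of a maximal order\<close>

lemma (in optimal_order) chain_antichain_shape:
  assumes ev: "even (card V)"
  obtains A D where "A \<union> D = V" "A \<inter> D = {}" "card A = card D" "is_chain r A" "is_antichain r D"
    "A \<times> D \<subseteq> r"
proof -
  obtain y where y: "y \<in> V" "\<And>v. v \<in> V \<Longrightarrow> (y, v) \<notin> r"
    using ex_maximal[of V] not_L_ne by blast
  then have y2: "(y, v) \<notin> r" for v using r_V by blast
  have LY: "L \<inter> cls y = {}" using top_not_L(2)[OF y(1) y2] by blast
  show ?thesis
  proof (rule that[of L "cls y"])
    show "L \<union> cls y = V" using two_layers[OF ev y(1) y2] by simp
    show "card L = card (cls y)" by (rule card_L_eq[OF ev y(1) y2])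
    show "is_chain r L" by (rule is_chain_L) simp
    show "is_antichain r (cls y)" using cls_incomp[OF y(1)] by (auto simp: is_antichain_def)
    show "L \<times> cls y \<subseteq> r" using top_above[OF y(1) y2] L_V LY by blast
  qed (rule LY)
qed

text \<open>Since \<open>k \<ge> 2\<close>, each member of an upper antichain has an incomparable
  partner and so lies in \<open>D\<close>; nothing in \<open>D\<close> is below another element of
  \<open>D\<close>, so the lower chain lies in \<open>A\<close>. All such choices of
  \<open>k\<close>-sets occur.\<close>

lemma card_occs_chain_antichain:
  assumes k: "k \<ge> 2" and fin: "finite V" and r: "strict_order_on V r"
    and AD: "A \<union> D = V" "A \<inter> D = {}" "is_chain r A" "is_antichain r D" "A \<times> D \<subseteq> r"
  shows "card (occs k V r) = (card A choose k) * (card D choose k)"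
proof -
  have finAD: "finite A" "finite D" using fin AD(1) by auto
  have "occs k V r = {S. S \<subseteq> A \<and> card S = k} \<times> {T. T \<subseteq> D \<and> card T = k}"
  proof (intro equalityI subrelI)
    fix S T assume o: "(S, T) \<in> occs k V r"
    note o' = occsD[OF o]
    have "finite T" using o'(2) fin finite_subset by blast
    have TD: "T \<subseteq> D"
    proof
      fix t assume t: "t \<in> T"
      obtain u where u: "u \<in> T" "u \<noteq> t"
        using \<open>finite T\<close> t o'(4) k by (metis card_le_Suc0_iff_eq not_less_eq_eq numeral_2_eq_2)
      have "u \<in> A \<union> D" "(t, u) \<notin> r" "(u, t) \<notin> r"
        using u t o'(2,6) AD(1) by (auto simp: is_antichain_def)
      then have "t \<notin> A" using AD(3,5) u unfolding is_chain_def by blast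
      then show "t \<in> D" using t o'(2) AD(1) by blast
    qed
    have "T \<noteq> {}" using o'(4) k by auto
    then obtain t where t: "t \<in> T" by blast
    have "s \<in> A" if s: "s \<in> S" for s
    proof (rule ccontr)
      assume "s \<notin> A"
      then have "s \<in> D" using s o'(1) AD(1) by blast
      then show False using o'(7)[OF s t] AD(4) t TD unfolding is_antichain_def by blast
    qed
    then show "(S, T) \<in> {S. S \<subseteq> A \<and> card S = k} \<times> {T. T \<subseteq> D \<and> card T = k}"
      using TD o'(3,4) by blast
  next
    fix S T assume "(S, T) \<in> {S. S \<subseteq> A \<and> card S = k} \<times> {T. T \<subseteq> D \<and> card T = k}"
    then show "(S, T) \<in> occs k V r"
      using AD is_chain_subset is_antichain_subset by (intro occsI) blast+
  qed
  then show ?thesis using finAD by (simp add: card_cartesian_product n_subsets)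
qed

text \<open>A maximal order exists because there are finitely many, and its shape determines its
  count. The order \<open>t\<close> ensures that this maximum is positive.\<close>

lemma optimal_order_bound:
  fixes V :: "'a::linorder set"
  assumes k: "k \<ge> 2" and n: "n \<ge> k" and V: "finite V" "card V = 2 * n"
    and t: "strict_order_on V t" "card (occs k V t) = (n choose k) ^ 2"
    and s: "strict_order_on V s"
  shows "card (occs k V s) \<le> (n choose k) ^ 2"
proof -
  define S where "S = {s :: ('a \<times> 'a) set. strict_order_on V s}"
  have "S \<subseteq> Pow (V \<times> V)" by (auto simp: S_def strict_order_on_def)
  then have finS: "finite S" using V(1) finite_subset by blast
  have "t \<in> S" using t by (simp add: S_def)
  then have "Max ((\<lambda>s. card (occs k V s)) ` S) \<in> (\<lambda>s. card (occs k V s)) ` S"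
    using finS by (intro Max_in) auto
  then obtain r where r: "r \<in> S" and max: "Max ((\<lambda>s. card (occs k V s)) ` S) = card (occs k V r)"
    by blast
  have le: "card (occs k V u) \<le> card (occs k V r)" if "strict_order_on V u" for u
    unfolding max[symmetric] using finS that by (intro Max_ge) (auto simp: S_def)
  have pos: "card (occs k V r) > 0" using le[OF t(1)] t(2) n by (simp add: order.strict_trans2[rotated])
  interpret optimal_order k V r
    using k V(1) r le pos by unfold_locales (auto simp: S_def)
  obtain A D where AD: "A \<union> D = V" "A \<inter> D = {}" "card A = card D" "is_chain r A"
      "is_antichain r D" "A \<times> D \<subseteq> r"
    using chain_antichain_shape V(2) by auto
  have "card A + card D = 2 * n"
    using card_Un_disjoint[OF _ _ AD(2)] AD(1) V by (metis finite_Un)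
  then have "card A = n" "card D = n" using AD(3) by auto
  then have "card (occs k V r) = (n choose k) ^ 2"
    using card_occs_chain_antichain[OF k V(1) order AD(1,2,4-6)] by (simp add: power2_eq_square)
  then show ?thesis using le[OF s] by simp
qed

section \<open>Permutations\<close>

text \<open>The non-inversions of \<open>\<sigma>\<close>: the intersection of the order of
  positions with the order of values.\<close>

definition perm_order :: "nat \<Rightarrow> (nat \<Rightarrow> nat) \<Rightarrow> (nat \<times> nat) set" where
  "perm_order N \<sigma> = {(i, j). i \<in> {1..N} \<and> j \<in> {1..N} \<and> i < j \<and> \<sigma> i < \<sigma> j}"

lemma strict_order_on_perm_order: "strict_order_on {1..N} (perm_order N \<sigma>)"
  by (auto simp: strict_order_on_def perm_order_def irrefl_def intro!: transI)

text \<open>Apart from being a permutation, this is all that is used about the pattern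
  later.\<close>

lemma tau_less_iff:
  assumes "1 \<le> i" "i < j" "j \<le> 2 * k"
  shows "one_line (tau_list k) i < one_line (tau_list k) j \<longleftrightarrow> i \<le> k"
proof -
  have low: "one_line (tau_list k) i = i" if "1 \<le> i" "i \<le> k" for i
    using that by (auto simp: one_line_def length_tau_list tau_list_def nth_append)
  \<comment> \<open>The decreasing half reflects the segment from \<open>k + 1\<close> to
    \<open>2 * k\<close>, whose ends add up to \<open>3 * k + 1\<close>.\<close>
  have high: "one_line (tau_list k) i = 3 * k + 1 - i" if "k < i" "i \<le> 2 * k" for i
  proof -
    have "one_line (tau_list k) i = tau_list k ! (i - 1)"
      using that by (simp add: one_line_def length_tau_list)
    also have "\<dots> = rev [k + 1..<2 * k + 1] ! (i - 1 - k)"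
      using that by (simp add: tau_list_def nth_append del: upt_Suc)
    also have "\<dots> = [k + 1..<2 * k + 1] ! (2 * k - i)"
      using that by (subst rev_nth) (auto simp del: upt_Suc)
    also have "\<dots> = 3 * k + 1 - i" using that by (subst nth_upt) auto
    finally show ?thesis .
  qed
  show ?thesis
    using assms low[of i] low[of j] high[of i] high[of j] by (cases "i \<le> k"; cases "j \<le> k") auto
qed

section \<open>Pattern occurrences as chains below antichains\<close>

lemma ex_strict_mono_enum:
  fixes A :: "nat set"
  assumes "finite A" "card A = k"
  obtains f where "strict_mono_on {1..k} f" "f ` {1..k} = A"
proof -
  obtain h where h: "bij_betw h {..<card A} A" "strict_mono_on {..<card A} h"
    using ex_bij_betw_strict_mono_card[OF assms(1)] by blast
  show ?thesis
  proof (rule that[of "\<lambda>i. h (i - 1)"])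
    show "strict_mono_on {1..k} (\<lambda>i. h (i - 1))"
      using assms(2) by (auto intro!: strict_mono_onI strict_mono_onD[OF h(2)])
    have "(\<lambda>i. i - 1) ` {1..k} = {..<k}"
      by (auto simp: image_iff intro!: bexI[of _ "Suc _"])
    then show "(\<lambda>i. h (i - 1)) ` {1..k} = A"
      using h(1) assms(2) by (metis (no_types) bij_betw_imp_surj_on image_image)
  qed
qed

text \<open>All positions in \<open>A\<close> precede those in \<open>D\<close>, so the increasing
  enumerations of \<open>A\<close> and \<open>D\<close>, put one after the other, enumerate the
  union.\<close>

lemma occs_perm_order_imp_occurrence:
  assumes \<sigma>: "\<sigma> permutes {1..N}" and k: "k \<ge> 1" and o: "(A, D) \<in> occs k {1..N} (perm_order N \<sigma>)"
  shows "A \<union> D \<in> occurrences (2 * k) (one_line (tau_list k)) N \<sigma>"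
proof -
  note o' = occsD[OF o]
  have fin: "finite A" "finite D" using o'(1,2) finite_subset by blast+
  have AD: "a < d" "\<sigma> a < \<sigma> d" if "a \<in> A" "d \<in> D" for a d
    using o'(7)[OF that] by (auto simp: perm_order_def)
  obtain f where f: "strict_mono_on {1..k} f" "f ` {1..k} = A"
    using ex_strict_mono_enum[OF fin(1) o'(3)] by blast
  obtain g where g: "strict_mono_on {1..k} g" "g ` {1..k} = D"
    using ex_strict_mono_enum[OF fin(2) o'(4)] by blast
  define h where "h = (\<lambda>i. if i \<le> k then f i else g (i - k))"
  have hA: "h i \<in> A" if "i \<in> {1..2 * k}" "i \<le> k" for i
    using that f(2) by (auto simp: h_def)
  have hD: "h i \<in> D" if "i \<in> {1..2 * k}" "\<not> i \<le> k" for i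
  proof -
    have "i - k \<in> {1..k}" using that by auto
    then show ?thesis using that g(2) by (auto simp: h_def)
  qed
  have mono: "h i < h j" if "i \<in> {1..2 * k}" "j \<in> {1..2 * k}" "i < j" for i j
  proof -
    consider "j \<le> k" | "i \<le> k" "\<not> j \<le> k" | "\<not> i \<le> k" by linarith
    then show ?thesis
    proof cases
      case 1
      then show ?thesis using that strict_mono_onD[OF f(1), of i j] by (simp add: h_def)
    next
      case 2
      then show ?thesis using AD(1) hA hD that by blast
    next
      case 3
      then show ?thesis using that strict_mono_onD[OF g(1), of "i - k" "j - k"] by (simp add: h_def)
    qed
  qed
  have less_iff: "\<sigma> (h i) < \<sigma> (h j) \<longleftrightarrow> i \<le> k" if "i \<in> {1..2 * k}" "j \<in> {1..2 * k}" "i < j" for i j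
  proof -
    have V: "h i \<in> {1..N}" "h j \<in> {1..N}" using hA hD that o'(1,2) by blast+
    consider "j \<le> k" | "i \<le> k" "\<not> j \<le> k" | "\<not> i \<le> k" by linarith
    then show ?thesis
    proof cases
      case 1
      then have "h i \<in> A" "h j \<in> A" "h i < h j" using hA mono that by auto
      then show ?thesis using o'(5) 1 that by (fastforce simp: is_chain_def perm_order_def)
    next
      case 2
      then show ?thesis using AD(2) hA hD that by blast
    next
      case 3
      then have "h i \<in> D" "h j \<in> D" "h i < h j" using hD mono that by auto
      then have "(h i, h j) \<notin> perm_order N \<sigma>" using o'(6) by (auto simp: is_antichain_def)
      then show ?thesis using 3 V \<open>h i < h j\<close> by (auto simp: perm_order_def)
    qed
  qed
  have "order_iso_to (2 * k) (one_line (tau_list k)) \<sigma> (A \<union> D)"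
    unfolding order_iso_to_def
  proof (intro exI conjI ballI)
    show "strict_mono_on {1..2 * k} h" using mono by (auto simp: strict_mono_on_def)
    show "h ` {1..2 * k} = A \<union> D"
    proof (intro equalityI subsetI)
      fix x assume "x \<in> A \<union> D"
      then show "x \<in> h ` {1..2 * k}"
      proof
        assume "x \<in> A"
        then obtain i where "i \<in> {1..k}" "x = f i" using f(2) by blast
        then show ?thesis by (intro image_eqI[of _ _ i]) (auto simp: h_def)
      next
        assume "x \<in> D"
        then obtain i where "i \<in> {1..k}" "x = g i" using g(2) by blast
        then show ?thesis by (intro image_eqI[of _ _ "i + k"]) (auto simp: h_def)
      qed
    qed (use hA hD in blast)
    fix i j assume ij: "i \<in> {1..2 * k}" "j \<in> {1..2 * k}"
    \<comment> \<open>Comparisons are known only for increasing positions; injectivity on both sides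
      reverses them.\<close>
    have inj: "\<sigma> (h i) \<noteq> \<sigma> (h j)" if "i \<noteq> j"
      using that mono[OF ij] mono[OF ij(2,1)] permutes_inj[OF \<sigma>] by (metis injD nat_neq_iff)
    have injt: "one_line (tau_list k) i \<noteq> one_line (tau_list k) j" if "i \<noteq> j"
      using that permutes_inj[OF one_line_tau_list_permutes] by (metis injD)
    consider "i < j" | "i = j" | "j < i" by linarith
    then show "\<sigma> (h i) < \<sigma> (h j) \<longleftrightarrow> one_line (tau_list k) i < one_line (tau_list k) j"
    proof cases
      case 1
      then show ?thesis using less_iff[OF ij] tau_less_iff[of i j k] ij by auto
    next
      case 3
      then have "\<sigma> (h j) < \<sigma> (h i) \<longleftrightarrow> one_line (tau_list k) j < one_line (tau_list k) i"
        using less_iff[OF ij(2,1)] tau_less_iff[of j i k] ij by auto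
      then show ?thesis using inj injt 3 by linarith
    qed simp
  qed
  moreover have "A \<inter> D = {}" using AD(1) by blast
  then have "card (A \<union> D) = 2 * k" using fin o'(3,4) by (simp add: card_Un_disjoint)
  ultimately show ?thesis using o'(1,2) by (auto simp: occurrences_def)
qed

text \<open>The first \<open>k\<close> positions of the occurrence form the chain and the last
  \<open>k\<close> the antichain.\<close>

lemma occurrence_imp_occs_perm_order:
  assumes "S \<in> occurrences (2 * k) (one_line (tau_list k)) N \<sigma>"
  obtains A D where "(A, D) \<in> occs k {1..N} (perm_order N \<sigma>)" "S = A \<union> D"
proof -
  have SN: "S \<subseteq> {1..N}" using assms by (simp add: occurrences_def)
  obtain f where mono: "strict_mono_on {1..2 * k} f" and S: "f ` {1..2 * k} = S"
    and iso: "\<And>i j. i \<in> {1..2 * k} \<Longrightarrow> j \<in> {1..2 * k} \<Longrightarrow>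
      \<sigma> (f i) < \<sigma> (f j) \<longleftrightarrow> one_line (tau_list k) i < one_line (tau_list k) j"
    using assms by (auto simp: occurrences_def order_iso_to_def)
  have inj: "inj_on f {1..2 * k}" by (rule strict_mono_on_imp_inj_on[OF mono])
  have f: "f i \<in> {1..N}" if "i \<in> {1..2 * k}" for i using that S SN by blast
  have less: "(f i, f j) \<in> perm_order N \<sigma> \<longleftrightarrow> i \<le> k"
    if "i \<in> {1..2 * k}" "j \<in> {1..2 * k}" "i < j" for i j
    using that iso[OF that(1,2)] tau_less_iff[of i j k] strict_mono_onD[OF mono that] f[OF that(1)] f[OF that(2)]
    by (simp add: perm_order_def)
  have less': "(f i, f j) \<notin> perm_order N \<sigma>"
    if "i \<in> {1..2 * k}" "j \<in> {1..2 * k}" "j \<le> i" for i j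
    using that strict_mono_onD[OF mono that(2,1)] by (cases "i = j") (auto simp: perm_order_def)
  have "(f ` {1..k}, f ` {k + 1..2 * k}) \<in> occs k {1..N} (perm_order N \<sigma>)"
  proof (rule occsI)
    show "f ` {1..k} \<subseteq> {1..N}" "f ` {k + 1..2 * k} \<subseteq> {1..N}" using f by auto
    show "card (f ` {1..k}) = k" "card (f ` {k + 1..2 * k}) = k"
      by (subst card_image; (rule inj_on_subset[OF inj])?; auto)+
    show "is_chain (perm_order N \<sigma>) (f ` {1..k})"
      unfolding is_chain_def
    proof (intro ballI impI, elim imageE)
      fix a b i j assume h: "a = f i" "b = f j" "i \<in> {1..k}" "j \<in> {1..k}" "a \<noteq> b"
      then have "i < j \<or> j < i" by (metis nat_neq_iff)
      then show "(a, b) \<in> perm_order N \<sigma> \<or> (b, a) \<in> perm_order N \<sigma>"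
        using h less[of i j] less[of j i] by auto
    qed
    show "is_antichain (perm_order N \<sigma>) (f ` {k + 1..2 * k})"
      unfolding is_antichain_def
    proof (intro ballI, elim imageE)
      fix a b i j assume h: "a = f i" "b = f j" "i \<in> {k + 1..2 * k}" "j \<in> {k + 1..2 * k}"
      then show "(a, b) \<notin> perm_order N \<sigma>"
        using less[of i j] less'[of i j] by (cases "i < j") auto
    qed
    show "(a, d) \<in> perm_order N \<sigma>" if "a \<in> f ` {1..k}" "d \<in> f ` {k + 1..2 * k}" for a d
      using that less by auto
  qed
  moreover have "{1..k} \<union> {k + 1..2 * k} = {1..2 * k}" by auto
  then have "S = f ` {1..k} \<union> f ` {k + 1..2 * k}" using S by (metis image_Un)
  ultimately show ?thesis using that by blast
qed

text \<open>The union determines the pair: if some \<open>a\<close> in \<open>A\<close> were in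
  \<open>D'\<close>, all of \<open>A'\<close> would precede \<open>a\<close> and all of
  \<open>D\<close> follow it, so \<open>A'\<close> would be contained in \<open>A\<close> and equal
  to it by size.\<close>

lemma occ_count_eq_card_occs:
  assumes \<sigma>: "\<sigma> permutes {1..N}" and k: "k \<ge> 1"
  shows "occ_count (2 * k) (one_line (tau_list k)) N \<sigma> = card (occs k {1..N} (perm_order N \<sigma>))"
proof -
  let ?O = "occs k {1..N} (perm_order N \<sigma>)"
  have sub: "A \<subseteq> A'" if o: "(A, D) \<in> ?O" "(A', D') \<in> ?O" and eq: "A \<union> D = A' \<union> D'" for A D A' D'
  proof (rule ccontr)
    note o1 = occsD[OF o(1)] and o2 = occsD[OF o(2)]
    assume "\<not> A \<subseteq> A'"
    then obtain a where a: "a \<in> A" "a \<notin> A'" "a \<in> D'" using eq by blast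
    have "b < a" if "b \<in> A'" for b using o2(7)[OF that a(3)] by (simp add: perm_order_def)
    moreover have "a < d" if "d \<in> D" for d using o1(7)[OF a(1) that] by (simp add: perm_order_def)
    ultimately have "A' \<subseteq> A" using eq by fastforce
    moreover have "finite A" using o1(1) finite_subset by blast
    ultimately have "A' = A" using o1(3) o2(3) card_subset_eq by metis
    then show False using a by blast
  qed
  have "inj_on (\<lambda>(A, D). A \<union> D) ?O"
  proof (rule inj_onI, clarify)
    fix A D A' D' assume o: "(A, D) \<in> ?O" "(A', D') \<in> ?O" and eq: "A \<union> D = A' \<union> D'"
    have "A = A'" using sub[OF o eq] sub[OF o(2,1) eq[symmetric]] by blast
    moreover have "A \<inter> D = {}" "A' \<inter> D' = {}"
      using occsD(7)[OF o(1)] occsD(7)[OF o(2)] by (fastforce simp: perm_order_def)+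
    ultimately show "A = A' \<and> D = D'" using eq by blast
  qed
  moreover have "(\<lambda>(A, D). A \<union> D) ` ?O = occurrences (2 * k) (one_line (tau_list k)) N \<sigma>"
  proof (intro equalityI subsetI)
    fix S assume "S \<in> (\<lambda>(A, D). A \<union> D) ` ?O"
    then show "S \<in> occurrences (2 * k) (one_line (tau_list k)) N \<sigma>"
      using occs_perm_order_imp_occurrence[OF \<sigma> k] by (elim imageE) (simp split: prod.splits)
  next
    fix S assume "S \<in> occurrences (2 * k) (one_line (tau_list k)) N \<sigma>"
    then obtain A D where "(A, D) \<in> ?O" "S = A \<union> D" by (rule occurrence_imp_occs_perm_order)
    then show "S \<in> (\<lambda>(A, D). A \<union> D) ` ?O" by (auto intro: rev_image_eqI)
  qed
  ultimately show ?thesis unfolding occ_count_def by (metis card_image)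
qed

text \<open>A value is its own rank: \<open>\<sigma> i\<close> is the number of positions whose
  value is at most \<open>\<sigma> i\<close>.\<close>

lemma permutes_eqI:
  fixes \<sigma> \<rho> :: "nat \<Rightarrow> nat"
  assumes \<sigma>: "\<sigma> permutes {1..N}" and \<rho>: "\<rho> permutes {1..N}"
    and eq: "\<And>i j. 1 \<le> i \<Longrightarrow> i < j \<Longrightarrow> j \<le> N \<Longrightarrow> \<sigma> i < \<sigma> j \<longleftrightarrow> \<rho> i < \<rho> j"
  shows "\<sigma> = \<rho>"
proof
  have rank: "p i = card {j \<in> {1..N}. p j \<le> p i}" if p: "p permutes {1..N}" and i: "i \<in> {1..N}" for p :: "nat \<Rightarrow> nat" and i
  proof -
    have "p ` {j \<in> {1..N}. p j \<le> p i} = {1..p i}"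
    proof (intro equalityI subsetI)
      fix v assume v: "v \<in> {1..p i}"
      moreover have "p i \<le> N" using permutes_in_image[OF p, of i] i by simp
      ultimately have "v \<in> p ` {1..N}" using permutes_image[OF p] by simp
      then show "v \<in> p ` {j \<in> {1..N}. p j \<le> p i}" using v by auto
    next
      fix v assume "v \<in> p ` {j \<in> {1..N}. p j \<le> p i}"
      then show "v \<in> {1..p i}" using permutes_in_image[OF p] by auto
    qed
    then show ?thesis
      using card_image[OF inj_on_subset[OF permutes_inj[OF p]], of "{j \<in> {1..N}. p j \<le> p i}"] by simp
  qed
  fix i
  show "\<sigma> i = \<rho> i"
  proof (cases "i \<in> {1..N}")
    case True
    have "\<sigma> j \<le> \<sigma> i \<longleftrightarrow> \<rho> j \<le> \<rho> i" if j: "j \<in> {1..N}" for j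
    proof -
      have ne: "\<sigma> i \<noteq> \<sigma> j" "\<rho> i \<noteq> \<rho> j" if "i \<noteq> j"
        using that permutes_inj[OF \<sigma>] permutes_inj[OF \<rho>] by (auto dest: injD)
      consider "i < j" | "i = j" | "j < i" by linarith
      then show ?thesis
      proof cases
        case 1
        then show ?thesis using eq[of i j] True j by auto
      next
        case 3
        then show ?thesis using eq[of j i] True j ne by auto
      qed simp
    qed
    then have "{j \<in> {1..N}. \<sigma> j \<le> \<sigma> i} = {j \<in> {1..N}. \<rho> j \<le> \<rho> i}" by blast
    then show ?thesis using rank[OF \<sigma> True] rank[OF \<rho> True] by simp
  next
    case False
    then show ?thesis using \<sigma> \<rho> by (simp add: permutes_not_in)
  qed
qed

text \<open>\<open>A\<close> precedes \<open>D\<close> in position, so it is the initial segment of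
  length \<open>n\<close>. For \<open>i < j\<close> this makes
  \<open>\<sigma> i < \<sigma> j\<close> equivalent to \<open>i \<le> n\<close>, as for the claimed
  permutation.\<close>

lemma eq_tau_of_chain_antichain:
  assumes \<sigma>: "\<sigma> permutes {1..2 * n}"
    and AD: "A \<union> D = {1..2 * n}" "A \<inter> D = {}" "card A = card D"
    and r: "is_chain (perm_order (2 * n) \<sigma>) A" "is_antichain (perm_order (2 * n) \<sigma>) D"
      "A \<times> D \<subseteq> perm_order (2 * n) \<sigma>"
  shows "\<sigma> = one_line (tau_list n)"
proof -
  have fin: "finite A" "finite D" using AD(1) by (metis finite_Un finite_atLeastAtMost)+
  have "card A + card D = 2 * n" using card_Un_disjoint[OF fin AD(2)] AD(1) by simp
  then have cA: "card A = n" using AD(3) by simp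
  have AlD: "a < d" if "a \<in> A" "d \<in> D" for a d using r(3) that by (auto simp: perm_order_def)
  have "A \<subseteq> {1..n}"
  proof
    fix a assume a: "a \<in> A"
    \<comment> \<open>A position up to \<open>a\<close> cannot be in \<open>D\<close>, whose
      elements all exceed \<open>a\<close>.\<close>
    have "{1..a} \<subseteq> A"
    proof
      fix j assume j: "j \<in> {1..a}"
      moreover have "a \<le> 2 * n" using a AD(1) by (metis UnI1 atLeastAtMost_iff)
      ultimately have "j \<in> A \<union> D" "j \<le> a" unfolding AD(1) by auto
      then show "j \<in> A" using AlD[OF a, of j] by auto
    qed
    then have "a \<le> n" using card_mono[OF fin(1), of "{1..a}"] cA by simp
    then show "a \<in> {1..n}" using a AD(1) by auto
  qed
  then have A: "A = {1..n}" using cA by (intro card_subset_eq) auto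
  have "D = {1..2 * n} - {1..n}" using AD(1,2) unfolding A by blast
  then have D: "D = {n + 1..2 * n}" by auto
  show ?thesis
  proof (rule permutes_eqI[OF \<sigma> one_line_tau_list_permutes])
    fix i j assume ij: "1 \<le> i" "i < j" "j \<le> 2 * n"
    have "\<sigma> i < \<sigma> j \<longleftrightarrow> i \<le> n"
    proof -
      have V: "i \<in> {1..2 * n}" "j \<in> {1..2 * n}" using ij by auto
      consider "j \<le> n" | "i \<le> n" "\<not> j \<le> n" | "\<not> i \<le> n" by linarith
      then show ?thesis
      proof cases
        case 1
        then have "i \<in> A" "j \<in> A" "i \<noteq> j" using ij A by auto
        then have "(i, j) \<in> perm_order (2 * n) \<sigma> \<or> (j, i) \<in> perm_order (2 * n) \<sigma>"
          using r(1) by (simp add: is_chain_def)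
        then show ?thesis using ij 1 by (auto simp: perm_order_def)
      next
        case 2
        then have "(i, j) \<in> perm_order (2 * n) \<sigma>" using r(3) ij A D by auto
        then show ?thesis using 2 by (auto simp: perm_order_def)
      next
        case 3
        then have "i \<in> D" "j \<in> D" using ij D by auto
        then have "(i, j) \<notin> perm_order (2 * n) \<sigma>" using r(2) by (simp add: is_antichain_def)
        then show ?thesis using 3 V ij by (auto simp: perm_order_def)
      qed
    qed
    then show "\<sigma> i < \<sigma> j \<longleftrightarrow> one_line (tau_list n) i < one_line (tau_list n) j"
      using tau_less_iff[OF ij] by simp
  qed
qed

lemma card_occs_tau:
  assumes "k \<ge> 2"
  shows "card (occs k {1..2 * n} (perm_order (2 * n) (one_line (tau_list n)))) = (n choose k) ^ 2"
proof -
  let ?r = "perm_order (2 * n) (one_line (tau_list n))"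
  have r: "(i, j) \<in> ?r \<longleftrightarrow> 1 \<le> i \<and> i < j \<and> j \<le> 2 * n \<and> i \<le> n" for i j
    using tau_less_iff[of i j n] by (auto simp: perm_order_def)
  have "card (occs k {1..2 * n} ?r) = (card {1..n} choose k) * (card {n + 1..2 * n} choose k)"
    by (rule card_occs_chain_antichain[OF assms _ strict_order_on_perm_order])
      (auto simp: is_chain_def is_antichain_def r)
  then show ?thesis by (simp add: power2_eq_square)
qed

theorem proposition2p1:
  fixes \<alpha> n :: nat and \<sigma> :: "nat \<Rightarrow> nat"
  assumes "\<alpha> \<ge> 2" and "n \<ge> \<alpha>"
    and "\<sigma> permutes {1..2 * n}"
  shows "pattern_maximal (2 * \<alpha>) (one_line (tau_list \<alpha>)) (2 * n) \<sigma> \<longleftrightarrow> \<sigma> = one_line (tau_list n)"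
proof -
  let ?V = "{1..2 * n}"
  let ?c = "occ_count (2 * \<alpha>) (one_line (tau_list \<alpha>)) (2 * n)"
  have count: "?c \<rho> = card (occs \<alpha> ?V (perm_order (2 * n) \<rho>))" if "\<rho> permutes ?V" for \<rho>
    using occ_count_eq_card_occs[OF that] assms(1) by simp
  \<comment> \<open>The order of the claimed permutation attains the bound and serves as the witness
    \<open>t\<close>.\<close>
  have bound: "card (occs \<alpha> ?V s) \<le> (n choose \<alpha>) ^ 2" if "strict_order_on ?V s" for s
    using optimal_order_bound[OF assms(1,2) _ _ strict_order_on_perm_order card_occs_tau[OF assms(1)] that]
    by simp
  have "max_occ_count (2 * \<alpha>) (one_line (tau_list \<alpha>)) (2 * n) = (n choose \<alpha>) ^ 2"
    unfolding max_occ_count_def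
  proof (rule Max_eqI)
    show "finite (?c ` {\<rho>. \<rho> permutes ?V})" by (intro finite_imageI finite_permutations) simp
    show "m \<le> (n choose \<alpha>) ^ 2" if "m \<in> ?c ` {\<rho>. \<rho> permutes ?V}" for m
      using that count bound[OF strict_order_on_perm_order] by auto
    show "(n choose \<alpha>) ^ 2 \<in> ?c ` {\<rho>. \<rho> permutes ?V}"
      using count card_occs_tau[OF assms(1)] one_line_tau_list_permutes by (metis image_eqI mem_Collect_eq)
  qed
  then have "pattern_maximal (2 * \<alpha>) (one_line (tau_list \<alpha>)) (2 * n) \<sigma> \<longleftrightarrow>
      card (occs \<alpha> ?V (perm_order (2 * n) \<sigma>)) = (n choose \<alpha>) ^ 2"
    using count assms(3) by (simp add: pattern_maximal_def)
  also have "\<dots> \<longleftrightarrow> \<sigma> = one_line (tau_list n)"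
  proof
    assume eq: "card (occs \<alpha> ?V (perm_order (2 * n) \<sigma>)) = (n choose \<alpha>) ^ 2"
    then have "card (occs \<alpha> ?V (perm_order (2 * n) \<sigma>)) > 0" using assms(2) by simp
    \<comment> \<open>A maximal permutation attains the bound valid for all strict orders, so its
      order is maximal among them and the shape result applies.\<close>
    then interpret optimal_order \<alpha> ?V "perm_order (2 * n) \<sigma>"
      using assms(1) strict_order_on_perm_order bound eq by unfold_locales auto
    have "even (card ?V)" by simp
    then show "\<sigma> = one_line (tau_list n)"
      using chain_antichain_shape eq_tau_of_chain_antichain[OF assms(3)] by metis
  qed (use card_occs_tau[OF assms(1)] in simp)
  finally show ?thesis .
qed

end
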